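(* Let $n\ge1$, let $A_i$, $B_i$ ($i\in[n]$) be finite nonempty sets, and let $M^{ab}_{ij}\ge0$ with $\sum_{j\in[n]}M^{ab}_{ij}=1$ and $r^{ab}_i\in\mathbb{R}$ be given for $i,j\in[n]$, $a\in A_i$, $b\in B_i$. Let $$f_i(v)=\min_{a\in A_i}\max_{b\in B_i}\Bigl(\sum_{j\in[n]}M^{ab}_{ij}v_j+r^{ab}_i\Bigr),\qquad i\in[n],\ v\in\mathbb{R}^n.$$ Assume that every matrix $M^{(\sigma\delta)}$, $\sigma\in A_{\mathrm M}$, $\delta\in B_{\mathrm M}$, has a unique final class, and that there is a state $c\in[n]$ common to all these classes, so that $$\bar{\mathcal T}_{ic}:=\max_{\sigma\in A_{\mathrm M},\,\delta\in B_{\mathrm M}}\mathcal T_{ic}(M^{(\sigma\delta)})<+\infty\quad\text{for all } i\in[n].$$ Let $K=\max_{i\in[n]}\bar{\mathcal T}_{ic}$ and let $m_1$ be the cardinality of $\{(i,a)\mid i\in[n],\ a\in A_i\}$. Then the Hoffman and Karp policy iteration algorithm for 2-player mean-payoff games, applied to $f$ with distinguished state $c$, stops after at most $s_{\max}$ (external) iterations, where $$s_{\max}:=(m_1-n)\Bigl(1+\Bigl\lfloor\frac{\log K}{\log(K/(K-1))}\Bigr\rfloor\Bigr)=\mathcal O\bigl((m_1-n)K\log K\bigr).$$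
   Context: $[n]=\{1,\dots,n\}$. Let $A\supseteq A_i$, $B\supseteq B_i$ for all $i$. $A_{\mathrm M}$ is the set of maps $\sigma:[n]\to A$ with $\sigma(i)\in A_i$; $B_{\mathrm M}$ is the set of maps $\delta:[n]\times A\to B$ with $\delta(i,a)\in B_i$. With $\sigma_i=\sigma(i)$ and $\delta_i=\delta(i,\sigma(i))$, put $M^{(\sigma\delta)}=(M^{\sigma_i\delta_i}_{ij})_{i,j}$, $r^{(\sigma\delta)}=(r^{\sigma_i\delta_i}_i)_i$, $f^{(\sigma\delta)}(v)=M^{(\sigma\delta)}v+r^{(\sigma\delta)}$, $f^{(\sigma)}(v)=\max_{\delta\in B_{\mathrm M}}f^{(\sigma\delta)}(v)$ (coordinatewise), so that $f(v)=\min_{\sigma\in A_{\mathrm M}}f^{(\sigma)}(v)$. A final class of a Markov (row-stochastic) matrix is a recurrent (closed communicating) class. $\mathcal T_{ij}(M)=\mathbb{E}[\inf\{k\ge1\mid X_k=j\}\mid X_0=i]$ for a Markov chain $(X_k)$ with transition matrix $M$. For $\eta\in\mathbb{R}$, $\eta+v=(\eta+v_i)_i$. General policy iteration algorithm for the mean payoff additive eigenproblem, with distinguished state $c$: (1) set $s=0$, choose $\sigma^0\in A_{\mathrm M}$ arbitrarily; (2) compute $\eta^s\in\mathbb{R}$, $v^s\in\mathbb{R}^n$ with $\eta^s+v^s=f^{(\sigma^s)}(v^s)$ and $v^s_c=0$; (3) choose $\sigma^{s+1}$ with $f(v^s)=f^{(\sigma^{s+1})}(v^s)$, taking $\sigma^{s+1}=\sigma^s$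 whenever possible; (4) if $\sigma^{s+1}=\sigma^s$ stop and return $\eta^s,v^s,\sigma^s$; otherwise increment $s$ and go to (2). The same algorithm is used with $\max$ in place of $\min$. Hoffman and Karp policy iteration algorithm for 2-player mean-payoff games: run the preceding algorithm on $A_{\mathrm M},f,(f^{(\sigma)})$ (external iterations); in step (2), compute $(\eta^s,v^s)$ by running the $\max$ version of the preceding algorithm on $B_{\mathrm M},f^{(\sigma^s)},(f^{(\sigma^s\delta)})_{\delta\in B_{\mathrm M}}$ (internal iterations), the linear problems for $f^{(\sigma^s\delta)}$ being solved exactly. Convention: iterations are numbered by $s$, starting from $0$; "stops after at most $s_{\max}$ iterations" means that the value of $s$ at which the algorithm stops is at most $s_{\max}$. When $K=1$ the quotient $\log K/\log(K/(K-1))$ is read as $0$. The $\mathcal O$ estimate is as $K\to\infty$ (with an absolute constant independent of $m_1-n$). *)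

theory Defs
  imports "HOL-Probability.Probability" "HOL-Library.Landau_Symbols"
begin

section \<open>Finite Markov chains\<close>

text \<open>The state space $[n]$ is the finite type \<open>'n\<close>; transition matrices are elements of
  \<^typ>\<open>real^'n^'n\<close>.\<close>

definition accessible :: "real^'n^'n \<Rightarrow> 'n \<Rightarrow> 'n \<Rightarrow> bool" where
  "accessible P i j \<longleftrightarrow> (i, j) \<in> {(k, l). P $ k $ l > 0}\<^sup>*"

definition communicating_class :: "real^'n^'n \<Rightarrow> 'n set \<Rightarrow> bool" where
  "communicating_class P C \<longleftrightarrow> (\<exists>i. C = {j. accessible P i j \<and> accessible P j i})"

definition final_class :: "real^'n^'n \<Rightarrow> 'n set \<Rightarrow> bool" where
  "final_class P C \<longleftrightarrow>
     communicating_class P C \<and> (\<forall>i\<in>C. \<forall>j. accessible P i j \<longrightarrow> j \<in> C)"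

text \<open>The law of the chain started in \<open>i\<close>, on trajectories \<^typ>\<open>nat \<Rightarrow> 'n\<close>, is given by the
  Ionescu-Tulcea extension theorem: time 0 has the Dirac law at \<open>i\<close>, and the law at time
  \<open>Suc k\<close> given the past \<open>\<omega>\<close> is row \<open>\<omega> k\<close> of the matrix.\<close>

definition chain_kernel :: "real^'n^'n \<Rightarrow> 'n \<Rightarrow> nat \<Rightarrow> (nat \<Rightarrow> 'n) \<Rightarrow> 'n measure" where
  "chain_kernel P i k \<omega> =
     (case k of 0 \<Rightarrow> return (count_space UNIV) i
      | Suc l \<Rightarrow> point_measure UNIV (\<lambda>j. ennreal (P $ \<omega> l $ j)))"

definition chain_law :: "real^'n^'n \<Rightarrow> 'n \<Rightarrow> (nat \<Rightarrow> 'n) measure" where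
  "chain_law P i =
     projective_family.lim UNIV
       (Ionescu_Tulcea.CI (chain_kernel P i) (\<lambda>_. count_space UNIV)) (\<lambda>_. count_space UNIV)"

definition row_stochastic :: "real^'n^'n \<Rightarrow> bool" where
  "row_stochastic P \<longleftrightarrow> (\<forall>i j. 0 \<le> P $ i $ j) \<and> (\<forall>i. (\<Sum>j\<in>UNIV. P $ i $ j) = 1)"

lemma Ionescu_Tulcea_chain_kernel:
  fixes P :: "real^'n^'n"
  assumes "row_stochastic P"
  shows "Ionescu_Tulcea (chain_kernel P i) (\<lambda>_. count_space UNIV)"
proof (rule Ionescu_Tulcea.intro)
  have row: "prob_space (point_measure UNIV (\<lambda>j. ennreal (P $ l $ j)))" for l
    using assms
    by (intro prob_space_point_measure) (simp_all add: row_stochastic_def sum_ennreal)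
  have prob: "prob_space (chain_kernel P i k \<omega>)" for k \<omega>
    by (cases k) (simp_all add: chain_kernel_def row prob_space_return)
  show "chain_kernel P i k \<in>
      measurable (PiM {0..<k} (\<lambda>_. count_space UNIV)) (subprob_algebra (count_space UNIV))" for k
  proof (cases k)
    case 0
    have "chain_kernel P i 0 = (\<lambda>_. return (count_space UNIV) i)"
      by (simp add: fun_eq_iff chain_kernel_def)
    with 0 show ?thesis
      by (simp add: space_subprob_algebra prob_space_imp_subprob_space prob_space_return)
  next
    case (Suc l)
    have "(\<lambda>x. point_measure UNIV (\<lambda>j. ennreal (P $ x $ j)))
        \<in> measurable (count_space UNIV) (subprob_algebra (count_space UNIV))"
      using row by (auto simp: measurable_def space_subprob_algebra sets_point_measure
            prob_space_imp_subprob_space)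
    moreover have "(\<lambda>\<omega>. \<omega> l) \<in> measurable (PiM {0..<k} (\<lambda>_. count_space UNIV)) (count_space UNIV)"
      using Suc by (intro measurable_component_singleton) simp
    ultimately show ?thesis
      unfolding chain_kernel_def Suc nat.case by (rule measurable_compose[rotated])
  qed
  show "prob_space (chain_kernel P i k \<omega>)"
    if "\<omega> \<in> space (PiM {0..<k} (\<lambda>_. count_space UNIV))" for k \<omega>
    by (rule prob)
qed

definition return_time :: "real^'n^'n \<Rightarrow> 'n \<Rightarrow> 'n \<Rightarrow> ennreal" where
  "return_time P i j =
     (\<integral>\<^sup>+\<omega>. (INF k\<in>{k. 1 \<le> k \<and> \<omega> k = j}. of_nat k) \<partial>chain_law P i)"


section \<open>The policy iteration scheme\<close>

text \<open>The scheme is parametrised by the set \<open>Pol\<close> of policies, the map \<open>f\<close>, the maps \<open>fp \<sigma>\<close> and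
  the relation \<open>evl \<sigma> \<eta> v\<close>: evaluating \<open>\<sigma>\<close> may yield \<open>(\<eta>, v)\<close>. Whether \<open>f\<close> is the minimum or
  the maximum of the \<open>fp \<sigma>\<close> plays no role in the formulation of the scheme.\<close>

definition improves ::
  "'p set \<Rightarrow> (real^'n \<Rightarrow> real^'n) \<Rightarrow> ('p \<Rightarrow> real^'n \<Rightarrow> real^'n) \<Rightarrow> 'p \<Rightarrow> real^'n \<Rightarrow> 'p \<Rightarrow> bool"
where
  "improves Pol f fp \<sigma> v \<sigma>' \<longleftrightarrow>
     \<sigma>' \<in> Pol \<and> f v = fp \<sigma>' v \<and> (f v = fp \<sigma> v \<longrightarrow> \<sigma>' = \<sigma>)"

text \<open>\<open>pi_reaches \<dots> s \<sigma>\<close>: some execution arrives at the evaluation step with counter \<open>s\<close> and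
  current policy \<open>\<sigma>\<close>.\<close>

inductive pi_reaches ::
  "'p set \<Rightarrow> (real^'n \<Rightarrow> real^'n) \<Rightarrow> ('p \<Rightarrow> real^'n \<Rightarrow> real^'n) \<Rightarrow>
   ('p \<Rightarrow> real \<Rightarrow> real^'n \<Rightarrow> bool) \<Rightarrow> nat \<Rightarrow> 'p \<Rightarrow> bool"
  for Pol f fp evl
where
  init: "\<sigma> \<in> Pol \<Longrightarrow> pi_reaches Pol f fp evl 0 \<sigma>"
| step: "pi_reaches Pol f fp evl s \<sigma> \<Longrightarrow> evl \<sigma> \<eta> v \<Longrightarrow> improves Pol f fp \<sigma> v \<sigma>' \<Longrightarrow> \<sigma>' \<noteq> \<sigma> \<Longrightarrow>
         pi_reaches Pol f fp evl (Suc s) \<sigma>'"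

definition pi_returns ::
  "'p set \<Rightarrow> (real^'n \<Rightarrow> real^'n) \<Rightarrow> ('p \<Rightarrow> real^'n \<Rightarrow> real^'n) \<Rightarrow>
   ('p \<Rightarrow> real \<Rightarrow> real^'n \<Rightarrow> bool) \<Rightarrow> nat \<Rightarrow> real \<Rightarrow> real^'n \<Rightarrow> 'p \<Rightarrow> bool"
where
  "pi_returns Pol f fp evl s \<eta> v \<sigma> \<longleftrightarrow>
     pi_reaches Pol f fp evl s \<sigma> \<and> evl \<sigma> \<eta> v \<and> improves Pol f fp \<sigma> v \<sigma>"

text \<open>Every execution stops with a counter at most \<open>N\<close>: the counter never exceeds \<open>N\<close>, and no
  execution gets stuck, neither at the evaluation nor at the improvement step.\<close>

definition pi_stops_within ::
  "'p set \<Rightarrow> (real^'n \<Rightarrow> real^'n) \<Rightarrow> ('p \<Rightarrow> real^'n \<Rightarrow> real^'n) \<Rightarrow>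
   ('p \<Rightarrow> real \<Rightarrow> real^'n \<Rightarrow> bool) \<Rightarrow> nat \<Rightarrow> bool"
where
  "pi_stops_within Pol f fp evl N \<longleftrightarrow>
     (\<forall>s \<sigma>. pi_reaches Pol f fp evl s \<sigma> \<longrightarrow>
        s \<le> N \<and> (\<exists>\<eta> v. evl \<sigma> \<eta> v) \<and>
        (\<forall>\<eta> v. evl \<sigma> \<eta> v \<longrightarrow> (\<exists>\<sigma>'. improves Pol f fp \<sigma> v \<sigma>')))"

text \<open>Exact solution of the eigenproblem; \<^term>\<open>vec \<eta> :: real^'n\<close> is the constant vector.\<close>

definition eigen_solution ::
  "'n \<Rightarrow> ('p \<Rightarrow> real^'n \<Rightarrow> real^'n) \<Rightarrow> 'p \<Rightarrow> real \<Rightarrow> real^'n \<Rightarrow> bool" where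
  "eigen_solution c fp p \<eta> v \<longleftrightarrow> vec \<eta> + v = fp p v \<and> v $ c = 0"


section \<open>Mean-payoff games\<close>

text \<open>The ambient action sets containing all \<open>A i\<close>, respectively all \<open>B i\<close>, are the types \<open>'a\<close>
  and \<open>'b\<close>. The entry $M^{ab}_{ij}$ is \<open>M i a b j\<close>, and $r^{ab}_i$ is \<open>r i a b\<close>; they are
  meaningful only for \<open>a \<in> A i\<close> and \<open>b \<in> B i\<close>.\<close>

definition min_policies :: "('n \<Rightarrow> 'a set) \<Rightarrow> ('n \<Rightarrow> 'a) set" where
  "min_policies A = {\<sigma>. \<forall>i. \<sigma> i \<in> A i}"

definition max_policies :: "('n \<Rightarrow> 'b set) \<Rightarrow> ('n \<times> 'a \<Rightarrow> 'b) set" where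
  "max_policies B = {\<delta>. \<forall>i a. \<delta> (i, a) \<in> B i}"

definition policy_matrix ::
  "('n \<Rightarrow> 'a \<Rightarrow> 'b \<Rightarrow> 'n \<Rightarrow> real) \<Rightarrow> ('n \<Rightarrow> 'a) \<Rightarrow> ('n \<times> 'a \<Rightarrow> 'b) \<Rightarrow> real^'n^'n" where
  "policy_matrix M \<sigma> \<delta> = (\<chi> i j. M i (\<sigma> i) (\<delta> (i, \<sigma> i)) j)"

definition policy_reward ::
  "('n \<Rightarrow> 'a \<Rightarrow> 'b \<Rightarrow> real) \<Rightarrow> ('n \<Rightarrow> 'a) \<Rightarrow> ('n \<times> 'a \<Rightarrow> 'b) \<Rightarrow> real^'n" where
  "policy_reward r \<sigma> \<delta> = (\<chi> i. r i (\<sigma> i) (\<delta> (i, \<sigma> i)))"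

definition f_pair ::
  "('n \<Rightarrow> 'a \<Rightarrow> 'b \<Rightarrow> 'n \<Rightarrow> real) \<Rightarrow> ('n \<Rightarrow> 'a \<Rightarrow> 'b \<Rightarrow> real) \<Rightarrow>
   ('n \<Rightarrow> 'a) \<Rightarrow> ('n \<times> 'a \<Rightarrow> 'b) \<Rightarrow> real^'n \<Rightarrow> real^'n" where
  "f_pair M r \<sigma> \<delta> v = policy_matrix M \<sigma> \<delta> *v v + policy_reward r \<sigma> \<delta>"

definition f_min_policy ::
  "('n \<Rightarrow> 'b set) \<Rightarrow> ('n \<Rightarrow> 'a \<Rightarrow> 'b \<Rightarrow> 'n \<Rightarrow> real) \<Rightarrow> ('n \<Rightarrow> 'a \<Rightarrow> 'b \<Rightarrow> real) \<Rightarrow>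
   ('n \<Rightarrow> 'a) \<Rightarrow> real^'n \<Rightarrow> real^'n" where
  "f_min_policy B M r \<sigma> v = (\<chi> i. Max ((\<lambda>\<delta>. f_pair M r \<sigma> \<delta> v $ i) ` max_policies B))"

definition f_game ::
  "('n \<Rightarrow> 'a set) \<Rightarrow> ('n \<Rightarrow> 'b set) \<Rightarrow> ('n \<Rightarrow> 'a \<Rightarrow> 'b \<Rightarrow> 'n \<Rightarrow> real) \<Rightarrow>
   ('n \<Rightarrow> 'a \<Rightarrow> 'b \<Rightarrow> real) \<Rightarrow> real^'n \<Rightarrow> real^'n" where
  "f_game A B M r v =
     (\<chi> i. Min ((\<lambda>a. Max ((\<lambda>b. (\<Sum>j\<in>UNIV. M i a b j * v $ j) + r i a b) ` B i)) ` A i))"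

definition max_return_time ::
  "('n::finite \<Rightarrow> 'a set) \<Rightarrow> ('n \<Rightarrow> 'b set) \<Rightarrow> ('n \<Rightarrow> 'a \<Rightarrow> 'b \<Rightarrow> 'n \<Rightarrow> real) \<Rightarrow> 'n \<Rightarrow> 'n \<Rightarrow> ennreal"
where
  "max_return_time A B M i c =
     Max ((\<lambda>(\<sigma>, \<delta>). return_time (policy_matrix M \<sigma> \<delta>) i c) ` (min_policies A \<times> max_policies B))"

definition return_bound ::
  "('n::finite \<Rightarrow> 'a set) \<Rightarrow> ('n \<Rightarrow> 'b set) \<Rightarrow> ('n \<Rightarrow> 'a \<Rightarrow> 'b \<Rightarrow> 'n \<Rightarrow> real) \<Rightarrow> 'n \<Rightarrow> real" where
  "return_bound A B M c = enn2real (Max (range (\<lambda>i. max_return_time A B M i c)))"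


section \<open>The Hoffman and Karp algorithm\<close>

text \<open>Evaluating \<open>\<sigma>\<close> amounts to running the internal policy iteration on the policies of the
  maximiser.\<close>

definition hk_eval ::
  "('n \<Rightarrow> 'b set) \<Rightarrow> ('n \<Rightarrow> 'a \<Rightarrow> 'b \<Rightarrow> 'n \<Rightarrow> real) \<Rightarrow> ('n \<Rightarrow> 'a \<Rightarrow> 'b \<Rightarrow> real) \<Rightarrow> 'n \<Rightarrow>
   ('n \<Rightarrow> 'a) \<Rightarrow> real \<Rightarrow> real^'n \<Rightarrow> bool" where
  "hk_eval B M r c \<sigma> \<eta> v \<longleftrightarrow>
     (\<exists>s \<delta>. pi_returns (max_policies B) (f_min_policy B M r \<sigma>) (f_pair M r \<sigma>)
              (eigen_solution c (f_pair M r \<sigma>)) s \<eta> v \<delta>)"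

text \<open>The bound \<open>N\<close> concerns the external iterations only, but every internal policy iteration that
  is started has to stop as well.\<close>

definition hk_stops_within ::
  "('n::finite \<Rightarrow> 'a set) \<Rightarrow> ('n \<Rightarrow> 'b set) \<Rightarrow> ('n \<Rightarrow> 'a \<Rightarrow> 'b \<Rightarrow> 'n \<Rightarrow> real) \<Rightarrow>
   ('n \<Rightarrow> 'a \<Rightarrow> 'b \<Rightarrow> real) \<Rightarrow> 'n \<Rightarrow> nat \<Rightarrow> bool" where
  "hk_stops_within A B M r c N \<longleftrightarrow>
     pi_stops_within (min_policies A) (f_game A B M r) (f_min_policy B M r) (hk_eval B M r c) N \<and>
     (\<forall>s \<sigma>. pi_reaches (min_policies A) (f_game A B M r) (f_min_policy B M r) (hk_eval B M r c) s \<sigma>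
        \<longrightarrow> (\<exists>N'. pi_stops_within (max_policies B) (f_min_policy B M r \<sigma>) (f_pair M r \<sigma>)
                   (eigen_solution c (f_pair M r \<sigma>)) N'))"

definition s_max :: "nat \<Rightarrow> real \<Rightarrow> nat" where
  "s_max m K = m * (1 + nat \<lfloor>if K = 1 then 0 else ln K / ln (K / (K - 1))\<rfloor>)"

end

theory Submission
  imports Defs
begin

text \<open>Let \<open>\<theta>\<close> be the vector of maximal expected return times to \<open>c\<close>. It satisfies the Bellman
  inequality \<open>\<theta> $ i \<ge> 1 + (\<Sum>j\<in>- {c}. M i a b j * \<theta> $ j)\<close> for all actions. In the variable
  \<open>w = v + \<eta>\<theta>\<close>, from which \<open>\<eta> = w $ c / \<theta> $ c\<close> and \<open>v\<close> can be recovered, the equation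
  \<open>\<eta> + v = f v\<close> becomes a fixed point problem \<open>w = F w\<close> in which all transition matrices are
  nonnegative and map \<open>\<theta>\<close> below \<open>\<theta> - 1 \<le> (1 - 1 / K) \<theta>\<close>. Hence policy iteration for the
  mean-payoff game is policy iteration for a discounted game with discount factor \<open>1 - 1 / K\<close> in
  the norm weighted by \<open>\<theta>\<close>, to which the argument of Hansen, Miltersen and Zwick applies.\<close>

section \<open>Return times of finite Markov chains\<close>

text \<open>The obstacle is that a stochastic matrix fixes the constant vectors, so the maps of the
  game contract strictly in no norm. The normalisation \<open>v $ c = 0\<close> deletes column
  \<open>c\<close>; the remaining matrix Q of a policy pair satisfies T = 1 + Q T for its return
  times T. The price is the extra unknown \<eta>. In the equation for \<open>w $ i\<close> its
  coefficient is \<open>\<theta> $ i - 1\<close> minus (Q \<theta>)_i, and monotonicity needs this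
  to be nonnegative for every choice of actions. Hence \<theta> must serve all policies at once; the
  return times of the current policy would not do. Improvement steps survive the substitution: at
  \<open>w = v + \<eta>\<theta>\<close> every transformed map differs from the original one at
  \<open>v\<close> by the same vector \<eta>(\<theta> - 1). The bound
  \<open>\<theta> $ i \<le> K\<close> enters twice, as the rate 1 - 1/K and as a factor K when a
  distance at one coordinate is compared with the largest defect. This is why L is chosen with K (1
  - 1/K)^L < 1.\<close>

definition taboo_step :: "real^'n^'n \<Rightarrow> 'n \<Rightarrow> ('n \<Rightarrow> ennreal) \<Rightarrow> 'n \<Rightarrow> ennreal" where
  "taboo_step P c g i = (\<Sum>j\<in>- {c}. ennreal (P $ i $ j) * g j)"

text \<open>The chain is killed on arrival at \<open>c\<close>, and the last transition is
  integrated out; this is why \<open>g\<close> is arbitrary in the induction.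
  \<open>C 0 (Suc m)\<close> is the law of the times 0 to m. The taboo starts at time 1, so the
  start \<open>i = c\<close> is covered.\<close>

lemma nn_integral_chain_taboo:
  fixes P :: "real^'n^'n"
  assumes P: "row_stochastic P"
  shows "(\<integral>\<^sup>+\<omega>. (if \<forall>l\<in>{1..m}. \<omega> l \<noteq> c then g (\<omega> m) else 0)
            \<partial>Ionescu_Tulcea.C (chain_kernel P i) (\<lambda>_. count_space UNIV) 0 (Suc m) (\<lambda>_. undefined))
         = (taboo_step P c ^^ m) g i"
proof -
  interpret IT: Ionescu_Tulcea "chain_kernel P i" "\<lambda>_. count_space UNIV"
    by (rule Ionescu_Tulcea_chain_kernel[OF P])
  let ?u = "\<lambda>_::nat. undefined :: 'n"
  have spu: "?u \<in> space (PiM {0..<0} (\<lambda>_. count_space UNIV))"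
    by (simp add: space_PiM)
  have meas: "(\<lambda>\<omega>. if \<forall>l\<in>{1..m}. \<omega> l \<noteq> c then g (\<omega> m) else 0)
      \<in> borel_measurable (PiM {0..<Suc m} (\<lambda>_. count_space UNIV))" for m and g :: "'n \<Rightarrow> ennreal"
  proof -
    have 1: "Measurable.pred (PiM {0..<Suc m} (\<lambda>_. count_space UNIV)) (\<lambda>\<omega>. \<omega> l \<noteq> c)"
      if "l \<in> {1..m}" for l
      using that by (intro measurable_compose[OF measurable_component_singleton]) auto
    have 2: "(\<lambda>\<omega>. g (\<omega> m)) \<in> borel_measurable (PiM {0..<Suc m} (\<lambda>_. count_space UNIV))"
      by (intro measurable_compose[OF measurable_component_singleton]) auto
    show ?thesis
      using pred_intros_finite(3)[where I="{1..m}" and P="\<lambda>\<omega> l. \<omega> l \<noteq> c", OF finite_atLeastAtMost 1]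
      by (intro measurable_If 2 borel_measurable_const) (simp_all add: pred_def)
  qed
  have step: "(\<integral>\<^sup>+\<omega>. f \<omega> \<partial>IT.C 0 (Suc m) ?u)
      = (\<integral>\<^sup>+\<omega>. \<integral>\<^sup>+x. f (fun_upd \<omega> m x) \<partial>chain_kernel P i m \<omega> \<partial>IT.C 0 m ?u)"
    if f: "f \<in> borel_measurable (PiM {0..<Suc m} (\<lambda>_. count_space UNIV))" for f m
  proof -
    have "(\<integral>\<^sup>+\<omega>. f \<omega> \<partial>IT.C 0 (Suc m) ?u) = (\<integral>\<^sup>+\<omega>. \<integral>\<^sup>+x. f x \<partial>IT.eP m \<omega> \<partial>IT.C 0 m ?u)"
      using f IT.measurable_eP[of m]
      by (simp add: nn_integral_bind[where B="PiM {0 ..< Suc m} (\<lambda>_. count_space UNIV)"]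
          measurable_cong_sets[OF IT.sets_C[OF spu] refl])
    also have "\<dots> = (\<integral>\<^sup>+\<omega>. \<integral>\<^sup>+x. f (fun_upd \<omega> m x) \<partial>chain_kernel P i m \<omega> \<partial>IT.C 0 m ?u)"
      using f by (intro nn_integral_cong IT.nn_integral_eP) (simp_all add: IT.space_C[OF spu])
    finally show ?thesis .
  qed
  show ?thesis
  proof (induction m arbitrary: g)
    case 0
    show ?case
      using meas[of 0 g]
      by (subst step) (simp_all add: chain_kernel_def nn_integral_return)
  next
    case (Suc m)
    have "(\<integral>\<^sup>+\<omega>. (if \<forall>l\<in>{1..Suc m}. \<omega> l \<noteq> c then g (\<omega> (Suc m)) else 0) \<partial>IT.C 0 (Suc (Suc m)) ?u)
      = (\<integral>\<^sup>+\<omega>. (\<integral>\<^sup>+x. (if \<forall>l\<in>{1..Suc m}. fun_upd \<omega> (Suc m) x l \<noteq> c then g (fun_upd \<omega> (Suc m) x (Suc m)) else 0)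
            \<partial>chain_kernel P i (Suc m) \<omega>) \<partial>IT.C 0 (Suc m) ?u)"
      by (rule step[OF meas])
    also have "\<dots> = (\<integral>\<^sup>+\<omega>. (if \<forall>l\<in>{1..m}. \<omega> l \<noteq> c then taboo_step P c g (\<omega> m) else 0) \<partial>IT.C 0 (Suc m) ?u)"
    proof (intro nn_integral_cong)
      fix \<omega>
      have "(if \<forall>l\<in>{1..Suc m}. fun_upd \<omega> (Suc m) x l \<noteq> c then g (fun_upd \<omega> (Suc m) x (Suc m)) else 0)
        = (if \<forall>l\<in>{1..m}. \<omega> l \<noteq> c then if x \<noteq> c then g x else 0 else 0)" for x
        by (auto simp: atLeastAtMostSuc_conv)
      moreover have "(\<Sum>x\<in>UNIV. ennreal (P $ \<omega> m $ x) * (if b then if x \<noteq> c then g x else 0 else 0))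
          = (if b then taboo_step P c g (\<omega> m) else 0)" for b
        unfolding taboo_step_def by (cases b, simp_all, rule sum.mono_neutral_cong_right) auto
      ultimately show "(\<integral>\<^sup>+x. (if \<forall>l\<in>{1..Suc m}. fun_upd \<omega> (Suc m) x l \<noteq> c then g (fun_upd \<omega> (Suc m) x (Suc m)) else 0)
            \<partial>chain_kernel P i (Suc m) \<omega>)
          = (if \<forall>l\<in>{1..m}. \<omega> l \<noteq> c then taboo_step P c g (\<omega> m) else 0)"
        by (simp only: chain_kernel_def nat.case nn_integral_point_measure_finite[OF finite])
    qed
    also have "\<dots> = (taboo_step P c ^^ m) (taboo_step P c g) i"
      by (rule Suc.IH)
    finally show ?case
      by (simp add: funpow_swap1)
  qed
qed

text \<open>Pathwise form of the tail-sum formula: the k-th term indicates that the hitting time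
  exceeds k. A path that never hits gives the infimum of the empty set, which is top, and an
  infinite sum of ones.\<close>

lemma Inf_hitting_time_eq_suminf:
  fixes \<omega> :: "nat \<Rightarrow> 'n"
  shows "(INF k\<in>{k. 1 \<le> k \<and> \<omega> k = c}. of_nat k :: ennreal)
    = (\<Sum>k. if \<forall>l\<in>{1..k}. \<omega> l \<noteq> c then 1 else 0)"
proof (cases "\<exists>k\<ge>1. \<omega> k = c")
  case True
  define m where "m = (LEAST k. 1 \<le> k \<and> \<omega> k = c)"
  have m: "1 \<le> m" "\<omega> m = c" and least: "\<And>k. 1 \<le> k \<Longrightarrow> \<omega> k = c \<Longrightarrow> m \<le> k"
    using LeastI_ex[of "\<lambda>k. 1 \<le> k \<and> \<omega> k = c"] True Least_le[of "\<lambda>k. 1 \<le> k \<and> \<omega> k = c"]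
    by (auto simp: m_def)
  have "(INF k\<in>{k. 1 \<le> k \<and> \<omega> k = c}. of_nat k :: ennreal) = of_nat m"
    using m least by (intro antisym INF_lower INF_greatest) auto
  moreover have "(\<forall>l\<in>{1..k}. \<omega> l \<noteq> c) \<longleftrightarrow> k \<in> {..<m}" for k
    using m least by (metis atLeastAtMost_iff lessThan_iff not_le order_trans le_less_trans)
  then have "(\<Sum>k. if \<forall>l\<in>{1..k}. \<omega> l \<noteq> c then 1 else 0 :: ennreal) = (\<Sum>k<m. 1)"
    by (subst suminf_finite[of "{..<m}"]) auto
  ultimately show ?thesis
    by simp
next
  case False
  then have "{k. 1 \<le> k \<and> \<omega> k = c} = {}"
    by auto
  moreover have "(\<Sum>k. if \<forall>l\<in>{1..k}. \<omega> l \<noteq> c then 1 else 0 :: ennreal) = (\<Sum>k. 1)"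
    using False by (intro arg_cong[where f=suminf]) auto
  moreover have "(\<Sum>k. 1 :: ennreal) = top"
    by (subst suminf_eq_SUP) (simp add: ennreal_SUP_of_nat_eq_top)
  ultimately show ?thesis
    by simp
qed

text \<open>The tail sum is integrated term by term. The k-th term depends on the times 0 to k only,
  so the law on infinite paths may be replaced by a finite-dimensional marginal.\<close>

lemma return_time_eq_suminf:
  fixes P :: "real^'n^'n"
  assumes P: "row_stochastic P"
  shows "return_time P i c = (\<Sum>k. (taboo_step P c ^^ k) (\<lambda>_. 1) i)"
proof -
  interpret IT: Ionescu_Tulcea "chain_kernel P i" "\<lambda>_. count_space UNIV"
    by (rule Ionescu_Tulcea_chain_kernel[OF P])
  let ?g = "\<lambda>(k::nat) \<omega>. if \<forall>l\<in>{1..k}. \<omega> l \<noteq> c then 1 else 0 :: ennreal"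
  have law: "chain_law P i = IT.PF.lim"
    by (simp add: chain_law_def)
  have meas: "?g k \<in> borel_measurable (PiM J (\<lambda>_. count_space UNIV))"
    if "{1..k} \<subseteq> J" for k J
  proof -
    have 1: "Measurable.pred (PiM J (\<lambda>_. count_space UNIV)) (\<lambda>\<omega>. \<omega> l \<noteq> c)"
      if "l \<in> {1..k}" for l
      using that \<open>{1..k} \<subseteq> J\<close> by (intro measurable_compose[OF measurable_component_singleton]) auto
    show ?thesis
      using pred_intros_finite(3)[where I="{1..k}" and P="\<lambda>\<omega> l. \<omega> l \<noteq> c", OF finite_atLeastAtMost 1]
      by (intro measurable_If borel_measurable_const) (simp_all add: pred_def)
  qed
  have "(\<integral>\<^sup>+\<omega>. ?g k \<omega> \<partial>chain_law P i) = (taboo_step P c ^^ k) (\<lambda>_. 1) i" for k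
  proof -
    let ?J = "{0..<Suc k}" and ?N = "\<lambda>_::nat. count_space (UNIV :: 'n set)"
    have "(\<integral>\<^sup>+\<omega>. ?g k \<omega> \<partial>IT.PF.lim) = (\<integral>\<^sup>+\<omega>. ?g k (restrict \<omega> ?J) \<partial>IT.PF.lim)"
      by (intro nn_integral_cong) (auto simp del: restrict_apply simp: restrict_apply')
    also have "\<dots> = (\<integral>\<^sup>+\<omega>. ?g k \<omega> \<partial>distr IT.PF.lim (PiM ?J ?N) (\<lambda>\<omega>. restrict \<omega> ?J))"
      using meas[of k ?J]
      by (intro nn_integral_distr[symmetric])
         (simp_all add: measurable_cong_sets[OF IT.PF.sets_lim refl] measurable_restrict_subset
           del: restrict_apply)
    also have "distr IT.PF.lim (PiM ?J ?N) (\<lambda>\<omega>. restrict \<omega> ?J) = IT.CI ?J"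
      by (rule IT.distr_lim) simp
    also have "\<dots> = IT.C 0 (Suc k) (\<lambda>_. undefined)"
    proof (rule measure_eqI)
      show "sets (IT.CI ?J) = sets (IT.C 0 (Suc k) (\<lambda>_. undefined))"
        by (subst IT.sets_C) (simp_all add: space_PiM IT.PF.sets_P)
    next
      fix X assume "X \<in> sets (IT.CI ?J)"
      then have X: "X \<in> sets (PiM ?J ?N)"
        by (simp add: IT.PF.sets_P)
      then show "emeasure (IT.CI ?J) X = emeasure (IT.C 0 (Suc k) (\<lambda>_. undefined)) X"
        using sets.sets_into_space[OF X]
        by (subst IT.emeasure_CI[of ?J "Suc k"]) (simp_all add: prod_emb_id space_PiM del: IT.C.simps)
    qed
    finally show ?thesis
      using nn_integral_chain_taboo[OF P, where g="\<lambda>_. 1" and m=k and c=c and i=i] by (simp add: law)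
  qed
  moreover have "return_time P i c = (\<Sum>k. \<integral>\<^sup>+\<omega>. ?g k \<omega> \<partial>chain_law P i)"
    unfolding return_time_def Inf_hitting_time_eq_suminf
    using meas[of _ UNIV]
    by (intro nn_integral_suminf) (simp add: law measurable_cong_sets[OF IT.PF.sets_lim refl])
  ultimately show ?thesis
    by simp
qed

lemma return_time_first_step:
  fixes P :: "real^'n^'n"
  assumes P: "row_stochastic P"
  shows "return_time P i c = 1 + (\<Sum>j\<in>- {c}. ennreal (P $ i $ j) * return_time P j c)"
proof -
  let ?u = "\<lambda>k. (taboo_step P c ^^ k) (\<lambda>_. 1)"
  have "(\<lambda>k. ?u (Suc k) i) sums (\<Sum>k. ?u (Suc k) i)"
    by (rule summable_sums) simp
  then have "(\<lambda>k. ?u k i) sums ((\<Sum>k. ?u (Suc k) i) + ?u 0 i)"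
    by (rule sums_Suc)
  then have "return_time P i c = (\<Sum>k. ?u (Suc k) i) + 1"
    unfolding return_time_eq_suminf[OF P] by (simp add: sums_iff)
  also have "(\<Sum>k. ?u (Suc k) i) = (\<Sum>k. \<Sum>j\<in>- {c}. ennreal (P $ i $ j) * ?u k j)"
    by (simp add: taboo_step_def)
  also have "\<dots> = (\<Sum>j\<in>- {c}. \<Sum>k. ennreal (P $ i $ j) * ?u k j)"
    by (rule suminf_sum) simp
  also have "\<dots> = (\<Sum>j\<in>- {c}. ennreal (P $ i $ j) * return_time P j c)"
    by (simp add: return_time_eq_suminf[OF P])
  finally show ?thesis
    by (simp add: add.commute)
qed

section \<open>Finiteness of the return times to an accessible state\<close>

lemma ex_maximal_index:
  fixes h :: "'n::finite \<Rightarrow> 'b::linorder"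
  obtains i where "\<And>j. h j \<le> h i"
proof -
  have "Max (range h) \<in> range h"
    by (rule Max_in) auto
  then obtain i where "h i = Max (range h)"
    by (metis imageE)
  then show thesis
    using Max_ge[of "range h"] by (intro that[of i]) auto
qed

text \<open>Among the states reachable from \<open>i\<close>, one with the smallest reachable set is
  returned to from everywhere it leads, so its class is final and contains \<open>c\<close>.\<close>

lemma accessible_if_in_final_classes:
  fixes P :: "real^'n^'n"
  assumes c: "\<And>C. final_class P C \<Longrightarrow> c \<in> C"
  shows "accessible P i c"
proof -
  have trans: "accessible P k m" if "accessible P k l" "accessible P l m" for k l m
    using that by (auto simp: accessible_def)
  have refl: "accessible P k k" for k
    by (simp add: accessible_def)
  define R where "R k = {l. accessible P k l}" for k
  obtain j where j: "accessible P i j" and least: "\<And>l. accessible P i l \<Longrightarrow> card (R j) \<le> card (R l)"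
    using ex_has_least_nat[of "accessible P i" i "\<lambda>k. card (R k)"] refl by auto
  define C where "C = {k. accessible P j k \<and> accessible P k j}"
  have return: "accessible P l j" if "accessible P j l" for l
  proof -
    have "R l \<subseteq> R j"
      using that trans by (auto simp: R_def)
    moreover have "card (R j) \<le> card (R l)"
      using least j that trans by blast
    ultimately have "R l = R j"
      by (simp add: card_subset_eq card_mono le_antisym)
    then show ?thesis
      using refl by (auto simp: R_def)
  qed
  have "final_class P C"
    unfolding final_class_def communicating_class_def C_def using trans return by blast
  then have "accessible P j c"
    using c[of C] by (auto simp: C_def)
  then show ?thesis
    using trans j by blast
qed

lemma ennreal_one_plus_sum_mult:
  assumes "\<And>j. j \<in> S \<Longrightarrow> 0 \<le> p j" "\<And>j. j \<in> S \<Longrightarrow> 0 \<le> y j"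
  shows "1 + (\<Sum>j\<in>S. ennreal (p j) * ennreal (y j)) = ennreal (1 + (\<Sum>j\<in>S. p j * y j))"
proof -
  have "(\<Sum>j\<in>S. ennreal (p j) * ennreal (y j)) = (\<Sum>j\<in>S. ennreal (p j * y j))"
    using assms by (intro sum.cong refl) (simp add: ennreal_mult)
  also have "\<dots> = ennreal (\<Sum>j\<in>S. p j * y j)"
    using assms by (intro sum_ennreal) simp
  finally show ?thesis
    using assms by (simp add: ennreal_plus sum_nonneg)
qed

text \<open>With Q the matrix \<open>P\<close> without column \<open>c\<close>, a maximum principle
  shows that 1 - Q is injective, hence x = 1 + Q x is solvable; the solution turns out to be
  nonnegative and dominates the series for the return time.\<close>

lemma return_time_finite:
  fixes P :: "real^'n^'n"
  assumes P: "row_stochastic P" and acc: "\<And>i. accessible P i c"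
  shows "return_time P i c < \<infinity>"
proof -
  have nonneg: "0 \<le> P $ i $ j" and row: "(\<Sum>j\<in>UNIV. P $ i $ j) = 1" for i j
    using P by (auto simp: row_stochastic_def)
  have row_le: "(\<Sum>j\<in>- {c}. P $ i $ j) \<le> 1" for i
    using sum_mono2[of UNIV "- {c}" "\<lambda>j. P $ i $ j"] nonneg row by auto
  define L :: "real^'n \<Rightarrow> real^'n" where "L x = (\<chi> i. x $ i - (\<Sum>j\<in>- {c}. P $ i $ j * x $ j))" for x
  have lin: "linear L"
    by (rule linearI)
       (simp_all add: L_def vec_eq_iff algebra_simps sum.distrib sum_distrib_left)
  have "x = 0" if "L x = 0" for x
  proof (rule ccontr)
    assume "x \<noteq> 0"
    have x: "x $ i = (\<Sum>j\<in>- {c}. P $ i $ j * x $ j)" for i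
      using arg_cong[OF that, of "\<lambda>v. v $ i"] by (simp add: L_def)
    obtain k where k: "\<And>j. \<bar>x $ j\<bar> \<le> \<bar>x $ k\<bar>"
      using ex_maximal_index[of "\<lambda>j. \<bar>x $ j\<bar>"] by blast
    have pos: "0 < \<bar>x $ k\<bar>"
      using \<open>x \<noteq> 0\<close> k by (force simp: vec_eq_iff)
    \<comment> \<open>At a maximal modulus the averaging inequality is an equality, so the
      nonnegative gaps \<open>y j\<close> vanish on all successors. Since \<open>y c\<close> is
      positive, \<open>c\<close> is not a successor.\<close>
    have succ: "j \<noteq> c \<and> \<bar>x $ j\<bar> = \<bar>x $ k\<bar>" if i: "\<bar>x $ i\<bar> = \<bar>x $ k\<bar>" and j: "0 < P $ i $ j" for i j
    proof -
      define y where "y j = \<bar>x $ k\<bar> - (if j = c then 0 else \<bar>x $ j\<bar>)" for j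
      have y: "0 \<le> y j" for j
        using k pos by (simp add: y_def)
      have "\<bar>x $ k\<bar> \<le> (\<Sum>j\<in>- {c}. \<bar>P $ i $ j * x $ j\<bar>)"
        unfolding i[symmetric] by (subst x) (rule sum_abs)
      also have "\<dots> = (\<Sum>j\<in>UNIV. P $ i $ j * (if j = c then 0 else \<bar>x $ j\<bar>))"
        using nonneg by (intro sum.mono_neutral_cong_left) (auto simp: abs_mult)
      finally have "(\<Sum>j\<in>UNIV. P $ i $ j * y j) \<le> 0"
        using row[of i]
        by (simp add: y_def right_diff_distrib sum_subtractf flip: sum_distrib_right)
      then have "P $ i $ j * y j = 0"
        using y nonneg sum_nonneg_eq_0_iff[of UNIV "\<lambda>j. P $ i $ j * y j"]
        by (simp add: order_antisym sum_nonneg)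
      then show ?thesis
        using j pos by (auto simp: y_def split: if_splits)
    qed
    \<comment> \<open>One transition is made first because \<open>k\<close> itself may be
      \<open>c\<close>, whereas a successor of \<open>k\<close> may not.\<close>
    obtain l where "0 < P $ k $ l"
      using row[of k] nonneg by (metis less_eq_real_def sum.neutral zero_neq_one)
    then have l: "l \<noteq> c \<and> \<bar>x $ l\<bar> = \<bar>x $ k\<bar>"
      by (rule succ[OF refl])
    have "m \<noteq> c \<and> \<bar>x $ m\<bar> = \<bar>x $ k\<bar>" if "(l, m) \<in> {(k, l). 0 < P $ k $ l}\<^sup>*" for m
      using that
    proof (induction rule: rtrancl_induct)
      case base
      show ?case by (rule l)
    next
      case (step i j)
      then show ?case using succ[of i j] by blast
    qed
    from this[of c] have "c \<noteq> c"
      using acc[of l] by (simp add: accessible_def)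
    then show False
      by simp
  qed
  then have "surj L"
    using lin by (intro linear_injective_imp_surjective) (auto simp: linear_injective_0)
  then obtain x where Lx: "L x = 1"
    by (metis surjD)
  have x: "x $ i = 1 + (\<Sum>j\<in>- {c}. P $ i $ j * x $ j)" for i
    using arg_cong[OF Lx, of "\<lambda>v. v $ i"] by (simp add: L_def)
  obtain k where k: "\<And>j. - x $ j \<le> - x $ k"
    using ex_maximal_index[of "\<lambda>j. - x $ j"] by blast
  \<comment> \<open>Rows of Q sum to at most 1, so a negative minimum would satisfy
    \<open>x $ k \<ge> 1 + x $ k\<close>.\<close>
  have "0 \<le> x $ k"
  proof (rule ccontr)
    assume neg: "\<not> 0 \<le> x $ k"
    have "x $ k \<le> (\<Sum>j\<in>- {c}. P $ k $ j) * x $ k"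
      using mult_right_mono_neg[OF row_le[of k], of "x $ k"] neg by simp
    also have "\<dots> \<le> (\<Sum>j\<in>- {c}. P $ k $ j * x $ j)"
      unfolding sum_distrib_right using k nonneg by (intro sum_mono mult_left_mono) auto
    finally show False
      using x[of k] by simp
  qed
  then have x0: "0 \<le> x $ i" for i
    using k[of i] by simp
  \<comment> \<open>The partial sums obey S_(N+1) = 1 + Q S_N with S_0 = 0, so they stay below the
    nonnegative solution \<open>x\<close>.\<close>
  have "(\<Sum>k<N. (taboo_step P c ^^ k) (\<lambda>_. 1) i) \<le> ennreal (x $ i)" for N i
  proof (induction N arbitrary: i)
    case 0
    show ?case by simp
  next
    case (Suc N)
    have "(\<Sum>k<Suc N. (taboo_step P c ^^ k) (\<lambda>_. 1) i)
        = 1 + (\<Sum>k<N. \<Sum>j\<in>- {c}. ennreal (P $ i $ j) * (taboo_step P c ^^ k) (\<lambda>_. 1) j)"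
      by (subst sum.lessThan_Suc_shift) (simp add: taboo_step_def)
    also have "\<dots> = 1 + (\<Sum>j\<in>- {c}. ennreal (P $ i $ j) * (\<Sum>k<N. (taboo_step P c ^^ k) (\<lambda>_. 1) j))"
      by (subst sum.swap) (simp add: sum_distrib_left)
    also have "\<dots> \<le> 1 + (\<Sum>j\<in>- {c}. ennreal (P $ i $ j) * ennreal (x $ j))"
      by (intro add_left_mono sum_mono mult_left_mono Suc.IH) simp
    also have "\<dots> = ennreal (1 + (\<Sum>j\<in>- {c}. P $ i $ j * x $ j))"
      using nonneg x0 by (intro ennreal_one_plus_sum_mult)
    finally show ?case
      by (simp flip: x)
  qed
  then have "return_time P i c \<le> ennreal (x $ i)"
    unfolding return_time_eq_suminf[OF P] suminf_eq_SUP by (intro SUP_least)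
  then show ?thesis
    by (simp add: le_less_trans)
qed

lemma enn2real_return_time_first_step:
  fixes P :: "real^'n^'n"
  assumes P: "row_stochastic P" and acc: "\<And>i. accessible P i c"
  shows "enn2real (return_time P i c) = 1 + (\<Sum>j\<in>- {c}. P $ i $ j * enn2real (return_time P j c))"
proof -
  have nonneg: "0 \<le> P $ i $ j" for i j
    using P by (auto simp: row_stochastic_def)
  have fin: "return_time P j c = ennreal (enn2real (return_time P j c))" for j
    using return_time_finite[OF P acc, of j] by simp
  have "return_time P i c = 1 + (\<Sum>j\<in>- {c}. ennreal (P $ i $ j) * ennreal (enn2real (return_time P j c)))"
    by (subst return_time_first_step[OF P]) (simp flip: fin)
  also have "\<dots> = ennreal (1 + (\<Sum>j\<in>- {c}. P $ i $ j * enn2real (return_time P j c)))"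
    using nonneg by (intro ennreal_one_plus_sum_mult) simp_all
  finally have "enn2real (return_time P i c)
      = enn2real (ennreal (1 + (\<Sum>j\<in>- {c}. P $ i $ j * enn2real (return_time P j c))))"
    by (rule arg_cong)
  then show ?thesis
    using nonneg by (simp add: sum_nonneg del: ennreal_plus)
qed

section \<open>Contracting maps and discounted policy iteration\<close>

text \<open>For \<open>\<kappa> = \<theta> $ i - 1\<close> this combines monotonicity (\<open>t = 0\<close>) with the contraction property in
  the norm weighted by \<open>\<theta>\<close>, in a form inherited by maxima and minima.\<close>

definition shrinking :: "real^'n \<Rightarrow> real \<Rightarrow> (real^'n \<Rightarrow> real) \<Rightarrow> bool" where
  "shrinking \<theta> \<kappa> h \<longleftrightarrow> (\<forall>v w t. 0 \<le> t \<longrightarrow> v \<le> w + t *\<^sub>R \<theta> \<longrightarrow> h v \<le> h w + t * \<kappa>)"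

definition contracting :: "real^'n \<Rightarrow> (real^'n \<Rightarrow> real^'n) \<Rightarrow> bool" where
  "contracting \<theta> F \<longleftrightarrow> (\<forall>i. 1 \<le> \<theta> $ i) \<and> (\<forall>i. shrinking \<theta> (\<theta> $ i - 1) (\<lambda>v. F v $ i))"

lemma shrinking_Max:
  fixes \<theta> :: "real^'n"
  assumes S: "finite S" "S \<noteq> {}" and h: "\<And>a. a \<in> S \<Longrightarrow> shrinking \<theta> \<kappa> (h a)"
  shows "shrinking \<theta> \<kappa> (\<lambda>v. Max ((\<lambda>a. h a v) ` S))"
  unfolding shrinking_def
proof (intro allI impI)
  fix v w :: "real^'n" and t :: real
  assume t: "0 \<le> t" "v \<le> w + t *\<^sub>R \<theta>"
  have "h a v \<le> Max ((\<lambda>a. h a w) ` S) + t * \<kappa>" if "a \<in> S" for a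
  proof -
    have "h a v \<le> h a w + t * \<kappa>"
      using h[OF that] t by (simp add: shrinking_def)
    also have "h a w \<le> Max ((\<lambda>a. h a w) ` S)"
      using S that by simp
    finally show ?thesis by simp
  qed
  then show "Max ((\<lambda>a. h a v) ` S) \<le> Max ((\<lambda>a. h a w) ` S) + t * \<kappa>"
    using S by simp
qed

lemma shrinking_Min:
  fixes \<theta> :: "real^'n"
  assumes S: "finite S" "S \<noteq> {}" and h: "\<And>a. a \<in> S \<Longrightarrow> shrinking \<theta> \<kappa> (h a)"
  shows "shrinking \<theta> \<kappa> (\<lambda>v. Min ((\<lambda>a. h a v) ` S))"
  unfolding shrinking_def
proof (intro allI impI)
  fix v w :: "real^'n" and t :: real
  assume t: "0 \<le> t" "v \<le> w + t *\<^sub>R \<theta>"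
  have "Min ((\<lambda>a. h a v) ` S) - t * \<kappa> \<le> h a w" if "a \<in> S" for a
  proof -
    have "h a v \<le> h a w + t * \<kappa>"
      using h[OF that] t by (simp add: shrinking_def)
    moreover have "Min ((\<lambda>a. h a v) ` S) \<le> h a v"
      using S that by simp
    ultimately show ?thesis by simp
  qed
  then have "Min ((\<lambda>a. h a v) ` S) - t * \<kappa> \<le> Min ((\<lambda>a. h a w) ` S)"
    using S by simp
  then show "Min ((\<lambda>a. h a v) ` S) \<le> Min ((\<lambda>a. h a w) ` S) + t * \<kappa>"
    by simp
qed

lemma contracting_mono:
  assumes F: "contracting \<theta> F" and "v \<le> w"
  shows "F v \<le> F w"
  unfolding less_eq_vec_def
proof
  fix i
  have "shrinking \<theta> (\<theta> $ i - 1) (\<lambda>v. F v $ i)"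
    using F by (simp add: contracting_def)
  then have "F v $ i \<le> F w $ i + 0 * (\<theta> $ i - 1)"
    using \<open>v \<le> w\<close> unfolding shrinking_def by (metis add.right_neutral order_refl scaleR_zero_left)
  then show "F v $ i \<le> F w $ i"
    by simp
qed

lemma contractingD:
  assumes "contracting \<theta> F" "0 \<le> t" "v \<le> w + t *\<^sub>R \<theta>"
  shows "F v \<le> F w + t *\<^sub>R (\<theta> - 1)"
  using assms by (simp add: contracting_def shrinking_def less_eq_vec_def)

text \<open>Comparison principle. Take the least t with
  \<open>v \<le> w + t *\<^sub>R \<theta>\<close>. If t were positive, applying \<open>F\<close>
  would improve this to \<open>w + t *\<^sub>R (\<theta> - 1)\<close>, contradicting equality at the
  index that defines t.\<close>

lemma contracting_le:
  assumes F: "contracting \<theta> F" and v: "v \<le> F v" and w: "F w \<le> w"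
  shows "v \<le> w"
proof -
  have \<theta>: "1 \<le> \<theta> $ i" for i
    using F by (simp add: contracting_def)
  have \<theta>0: "0 < \<theta> $ i" for i
    using \<theta>[of i] by simp
  obtain k where k: "\<And>j. (v $ j - w $ j) / \<theta> $ j \<le> (v $ k - w $ k) / \<theta> $ k"
    using ex_maximal_index[of "\<lambda>j. (v $ j - w $ j) / \<theta> $ j"] by blast
  define t where "t = (v $ k - w $ k) / \<theta> $ k"
  have le: "v $ j \<le> w $ j + t * \<theta> $ j" for j
    using k[of j] \<theta>0[of j] by (simp add: t_def[symmetric] pos_divide_le_eq)
  have t0: "t \<le> 0"
  proof (rule ccontr)
    assume "\<not> t \<le> 0"
    then have "F v \<le> F w + t *\<^sub>R (\<theta> - 1)"
      using le by (intro contractingD[OF F]) (auto simp: less_eq_vec_def)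
    then have "F v $ k \<le> F w $ k + t * (\<theta> $ k - 1)"
      by (simp add: less_eq_vec_def)
    moreover have "v $ k \<le> F v $ k" "F w $ k \<le> w $ k"
      using v w by (auto simp: less_eq_vec_def)
    moreover have "v $ k = w $ k + t * \<theta> $ k"
      using \<theta>0[of k] by (simp add: t_def)
    ultimately show False
      using \<open>\<not> t \<le> 0\<close> by (simp add: algebra_simps)
  qed
  have "v $ j \<le> w $ j" for j
    using le[of j] mult_nonpos_nonneg[OF t0 less_imp_le[OF \<theta>0[of j]]] by simp
  then show ?thesis
    by (simp add: less_eq_vec_def)
qed

text \<open>The fixed point is the coordinatewise supremum of the subsolutions, as in the Knaster--Tarski
  theorem; multiples of \<open>\<theta>\<close> provide a subsolution and an upper bound.\<close>

lemma contracting_ex1_fixed_point: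
  assumes F: "contracting \<theta> F"
  shows "\<exists>!w. F w = w"
proof -
  obtain k where k: "\<And>j. \<bar>F 0 $ j\<bar> \<le> \<bar>F 0 $ k\<bar>"
    using ex_maximal_index[of "\<lambda>j. \<bar>F 0 $ j\<bar>"] by blast
  \<comment> \<open>With t the sup norm of \<open>F 0\<close>, shrinking bounds F(t\<theta>) by t +
    t(\<theta> - 1) = t\<theta>, and symmetrically from below at -t\<theta>.\<close>
  define t where "t = \<bar>F 0 $ k\<bar>"
  have t: "0 \<le> t" "F 0 $ j \<le> t" "- t \<le> F 0 $ j" for j
    using k[of j] by (auto simp: t_def)
  have "F (t *\<^sub>R \<theta>) \<le> F 0 + t *\<^sub>R (\<theta> - 1)"
    using t by (intro contractingD[OF F]) simp_all
  then have *: "F (t *\<^sub>R \<theta>) $ j \<le> F 0 $ j + t * (\<theta> $ j - 1)" for j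
    by (simp add: less_eq_vec_def)
  have "F (t *\<^sub>R \<theta>) $ j \<le> t * \<theta> $ j" for j
    using *[of j] t(2)[of j] by (simp add: algebra_simps)
  then have super: "F (t *\<^sub>R \<theta>) \<le> t *\<^sub>R \<theta>"
    by (simp add: less_eq_vec_def)
  have "F 0 \<le> F (- (t *\<^sub>R \<theta>)) + t *\<^sub>R (\<theta> - 1)"
    using t by (intro contractingD[OF F]) simp_all
  then have *: "F 0 $ j \<le> F (- (t *\<^sub>R \<theta>)) $ j + t * (\<theta> $ j - 1)" for j
    by (simp add: less_eq_vec_def)
  have "- (t * \<theta> $ j) \<le> F (- (t *\<^sub>R \<theta>)) $ j" for j
    using *[of j] t(3)[of j] by (simp add: algebra_simps)
  then have sub: "- (t *\<^sub>R \<theta>) \<le> F (- (t *\<^sub>R \<theta>))"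
    by (simp add: less_eq_vec_def)
  define S where "S = {v. v \<le> F v}"
  have bdd: "bdd_above ((\<lambda>v. v $ i) ` S)" for i
    using contracting_le[OF F _ super] by (intro bdd_aboveI[of _ "t * \<theta> $ i"]) (auto simp: S_def less_eq_vec_def)
  define w where "w = (\<chi> i. SUP v\<in>S. v $ i)"
  have upper: "v \<le> w" if "v \<in> S" for v
    using cSUP_upper[OF that bdd] by (simp add: w_def less_eq_vec_def)
  have "w \<le> F w"
    unfolding less_eq_vec_def
  proof
    fix i
    have "v $ i \<le> F w $ i" if "v \<in> S" for v
      using that contracting_mono[OF F upper[OF that]] by (auto simp: S_def less_eq_vec_def intro: order_trans)
    then show "w $ i \<le> F w $ i"
      using sub by (auto simp: w_def S_def intro!: cSUP_least)
  qed
  moreover from this have "F w \<le> w"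
    by (intro upper) (simp add: S_def contracting_mono[OF F])
  ultimately have "F w = w"
    by simp
  moreover have "v = w" if "F v = v" for v
    using contracting_le[OF F, of v w] contracting_le[OF F, of w v] that \<open>F w = w\<close> by simp
  ultimately show ?thesis
    by blast
qed

text \<open>Hansen, Miltersen and Zwick's argument: among the pairs \<open>(i, \<sigma> t i)\<close>, the one with the
  largest defect \<open>h i (\<sigma> t i) w\<^sup>* - w\<^sup>* $ i\<close> with respect to the optimal value \<open>w\<^sup>*\<close> cannot be
  used any more from time \<open>t + L\<close> on, since by then the distance to \<open>w\<^sup>*\<close>, which bounds the
  defects, has decreased too much. Pairs occurring in an optimal policy have defect \<open>0\<close>.\<close>

lemma policy_iteration_length_le:
  fixes A :: "'n::finite \<Rightarrow> 'a set" and h :: "'n \<Rightarrow> 'a \<Rightarrow> real^'n \<Rightarrow> real"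
  assumes A: "\<And>i. finite (A i)" "\<And>i. A i \<noteq> {}"
    and \<theta>: "\<And>i. 1 \<le> \<theta> $ i" "\<And>i. \<theta> $ i \<le> K"
    and h: "\<And>i a. a \<in> A i \<Longrightarrow> shrinking \<theta> (\<theta> $ i - 1) (h i a)"
    and L: "1 \<le> L" "K * (1 - 1 / K) ^ L < 1"
    and \<sigma>: "\<And>t. t \<le> N \<Longrightarrow> \<sigma> t \<in> min_policies A"
    and w: "\<And>t. t \<le> N \<Longrightarrow> (\<chi> i. h i (\<sigma> t i) (w t)) = w t"
    and impr: "\<And>t. t < N \<Longrightarrow> (\<chi> i. h i (\<sigma> (Suc t) i) (w t)) = (\<chi> i. Min ((\<lambda>a. h i a (w t)) ` A i))"
    and strict: "\<And>t. t < N \<Longrightarrow> (\<chi> i. Min ((\<lambda>a. h i a (w t)) ` A i)) \<noteq> w t"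
  shows "N \<le> (card (SIGMA i:UNIV. A i) - CARD('n)) * L"
proof (rule ccontr)
  define F where "F w = (\<chi> i. Min ((\<lambda>a. h i a w) ` A i))" for w
  define G where "G t w = (\<chi> i. h i (\<sigma> t i) w)" for t w
  have F: "contracting \<theta> F"
    using A \<theta> h by (auto simp: contracting_def F_def intro!: shrinking_Min)
  have G: "contracting \<theta> (G t)" if "t \<le> N" for t
    using \<sigma>[OF that] \<theta> h by (auto simp: contracting_def G_def min_policies_def)
  have FG: "F x \<le> G t x" if "t \<le> N" for t x
    using \<sigma>[OF that] A by (auto simp: F_def G_def less_eq_vec_def min_policies_def)
  have w: "G t (w t) = w t" if "t \<le> N" for t
    using w[OF that] by (simp add: G_def)
  have impr: "G (Suc t) (w t) = F (w t)" if "t < N" for t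
    using impr[OF that] by (simp add: G_def F_def)
  have strict: "F (w t) \<noteq> w t" if "t < N" for t
    using strict[OF that] by (simp add: F_def)
  obtain z where z: "F z = z"
    using contracting_ex1_fixed_point[OF F] by blast
  have K: "1 \<le> K"
    using \<theta> order_trans by blast
  define d where "d i a = h i a z - z $ i" for i a
  have d0: "0 \<le> d i a" if "a \<in> A i" for i a
  proof -
    have "z $ i = Min ((\<lambda>a. h i a z) ` A i)"
      using arg_cong[OF z, of "\<lambda>v. v $ i"] by (simp add: F_def)
    then show ?thesis
      using A that by (simp add: d_def)
  qed
  have lower: "z \<le> w t" if "t \<le> N" for t
    using z FG[OF that, of "w t"] w[OF that] by (auto intro: contracting_le[OF F, of z "w t"])
  have defect_le: "d i (\<sigma> t i) \<le> w t $ i - z $ i" if "t \<le> N" for t i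
  proof -
    have "G t z \<le> w t"
      using contracting_mono[OF G[OF that] lower[OF that]] w[OF that] by simp
    then show ?thesis
      by (simp add: d_def G_def less_eq_vec_def)
  qed
  \<comment> \<open>Converse of \<open>defect_le\<close>: if no defect exceeds \<mu>, then z +
    \<mu>\<theta> is a supersolution for the current policy, since \<mu> + \<mu>(\<theta> - 1) =
    \<mu>\<theta>.\<close>
  have dist_le: "w t \<le> z + \<mu> *\<^sub>R \<theta>" if "t \<le> N" "0 \<le> \<mu>" "\<And>i. d i (\<sigma> t i) \<le> \<mu>" for t \<mu>
  proof (rule contracting_le[OF G[OF that(1)]])
    have "G t (z + \<mu> *\<^sub>R \<theta>) \<le> G t z + \<mu> *\<^sub>R (\<theta> - 1)"
      using that by (intro contractingD[OF G]) simp_all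
    then have *: "G t (z + \<mu> *\<^sub>R \<theta>) $ i \<le> G t z $ i + \<mu> * (\<theta> $ i - 1)" for i
      by (simp add: less_eq_vec_def)
    have "G t (z + \<mu> *\<^sub>R \<theta>) $ i \<le> z $ i + \<mu> * \<theta> $ i" for i
      using that(3)[of i] *[of i] by (simp add: d_def G_def algebra_simps)
    then show "G t (z + \<mu> *\<^sub>R \<theta>) \<le> z + \<mu> *\<^sub>R \<theta>"
      by (simp add: less_eq_vec_def)
  qed (simp add: w that)
  \<comment> \<open>One policy improvement is at least as good as one application of
    \<open>F\<close>, and \<open>F\<close> approaches \<open>z\<close> at rate 1 - 1/K because
    \<theta> - 1 \<le> (1 - 1/K)\<theta> amounts to \<theta> \<le> K.\<close>
  have contr: "w (t + k) \<le> z + (\<mu> * (1 - 1 / K) ^ k) *\<^sub>R \<theta>"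
    if "t + k \<le> N" "0 \<le> \<mu>" "w t \<le> z + \<mu> *\<^sub>R \<theta>" for t k \<mu>
    using that(1)
  proof (induction k)
    case 0
    then show ?case using that by simp
  next
    case (Suc k)
    define \<nu> where "\<nu> = \<mu> * (1 - 1 / K) ^ k"
    have \<nu>: "0 \<le> \<nu>"
      using that K by (simp add: \<nu>_def)
    have "G (Suc (t + k)) (w (t + k)) \<le> G (t + k) (w (t + k))"
      using impr[of "t + k"] FG[of "t + k"] Suc.prems by simp
    then have "w (Suc (t + k)) \<le> w (t + k)"
      using Suc.prems w[of "t + k"] w[of "Suc (t + k)"]
      by (auto intro: contracting_le[OF G, of "Suc (t + k)" "w (Suc (t + k))" "w (t + k)"])
    then have "G (Suc (t + k)) (w (Suc (t + k))) \<le> G (Suc (t + k)) (w (t + k))"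
      using Suc.prems by (intro contracting_mono[OF G]) simp_all
    then have "w (Suc (t + k)) \<le> F (w (t + k))"
      using Suc.prems w[of "Suc (t + k)"] impr[of "t + k"] by simp
    also have "\<dots> \<le> F z + \<nu> *\<^sub>R (\<theta> - 1)"
      using Suc \<nu> by (intro contractingD[OF F]) (simp_all add: \<nu>_def)
    also have "\<dots> \<le> z + (\<nu> * (1 - 1 / K)) *\<^sub>R \<theta>"
    proof -
      have "\<theta> $ i - 1 \<le> (1 - 1 / K) * \<theta> $ i" for i
        using \<theta>(2)[of i] K by (simp add: field_simps)
      then have "\<nu> * (\<theta> $ i - 1) \<le> \<nu> * (1 - 1 / K) * \<theta> $ i" for i
        using \<nu> by (simp add: mult.assoc mult_left_mono)
      then show ?thesis
        by (simp add: z less_eq_vec_def)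
    qed
    finally show ?case
      by (simp add: \<nu>_def mult_ac)
  qed
  have "\<exists>i. 0 < d i (\<sigma> t i) \<and> (\<forall>s. t + L \<le> s \<and> s \<le> N \<longrightarrow> \<sigma> s i \<noteq> \<sigma> t i)" if t: "t < N" for t
  proof -
    obtain i where i: "\<And>j. d j (\<sigma> t j) \<le> d i (\<sigma> t i)"
      using ex_maximal_index[of "\<lambda>j. d j (\<sigma> t j)"] by blast
    define \<mu> where "\<mu> = d i (\<sigma> t i)"
    have \<mu>0: "0 \<le> \<mu>"
      using d0 \<sigma>[of t] t by (simp add: \<mu>_def min_policies_def)
    have dist: "w t \<le> z + \<mu> *\<^sub>R \<theta>"
      using dist_le[of t \<mu>] t \<mu>0 i by (simp add: \<mu>_def)
    \<comment> \<open>Zero defects would force \<open>w t = z\<close>, a fixed point of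
      \<open>F\<close>, where the iteration would have stopped.\<close>
    have "\<mu> \<noteq> 0"
      using dist lower[of t] strict[OF t] z t by auto
    then have \<mu>: "0 < \<mu>"
      using \<mu>0 by simp
    have "\<sigma> s i \<noteq> \<sigma> t i" if s: "t + L \<le> s" "s \<le> N" for s
    proof
      assume "\<sigma> s i = \<sigma> t i"
      define k where "k = s - t"
      have k: "s = t + k" "L \<le> k"
        using s by (auto simp: k_def)
      have "\<mu> \<le> w s $ i - z $ i"
        using defect_le[of s i] s \<open>\<sigma> s i = \<sigma> t i\<close> by (simp add: \<mu>_def)
      also have "\<dots> \<le> (\<mu> * (1 - 1 / K) ^ k) * \<theta> $ i"
        using contr[of t k \<mu>] s k \<mu>0 dist by (simp add: less_eq_vec_def algebra_simps)
      also have "\<dots> \<le> (\<mu> * (1 - 1 / K) ^ L) * K"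
        using \<theta>[of i] K k \<mu>0 by (intro mult_mono mult_left_mono power_decreasing) auto
      also have "\<dots> = \<mu> * (K * (1 - 1 / K) ^ L)"
        by simp
      also have "\<dots> < \<mu> * 1"
        using L \<mu> by (intro mult_strict_left_mono) auto
      finally show False
        by simp
    qed
    then show ?thesis
      using \<mu> by (auto simp: \<mu>_def)
  qed
  then obtain e where e: "\<And>t. t < N \<Longrightarrow> 0 < d (e t) (\<sigma> t (e t))"
      "\<And>t s. t < N \<Longrightarrow> t + L \<le> s \<Longrightarrow> s \<le> N \<Longrightarrow> \<sigma> s (e t) \<noteq> \<sigma> t (e t)"
    by metis
  define m where "m = card (SIGMA i:UNIV. A i) - CARD('n)"
  assume "\<not> N \<le> (card (SIGMA i:UNIV. A i) - CARD('n)) * L"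
  then have N: "m * L < N"
    by (simp add: m_def)
  have tN: "t * L < N" if "t \<le> m" for t
    by (rule le_less_trans[OF mult_le_mono1[OF that] N])
  define E where "E = {(i, a). a \<in> A i \<and> 0 < d i a}"
  \<comment> \<open>Sampling every L-th time makes the discarded pairs distinct. The m + 1 samples
    0, L, ..., mL all lie below N, while at most m pairs have positive defect.\<close>
  define g where "g t = (e (t * L), \<sigma> (t * L) (e (t * L)))" for t
  have "inj_on g {..m}"
  proof (rule linorder_inj_onI)
    fix s t
    assume st: "s < t" "t \<in> {..m}"
    then have "s * L + L \<le> t * L"
      using mult_le_mono1[of "Suc s" t L] by simp
    then show "g s \<noteq> g t"
      using e(2)[of "s * L" "t * L"] tN[of s] tN[of t] st by (auto simp: g_def)
  qed auto
  moreover have "g ` {..m} \<subseteq> E"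
    using e(1) tN \<sigma> by (auto simp: g_def E_def min_policies_def less_imp_le)
  moreover have fin: "finite (SIGMA i:UNIV. A i)"
    using A by simp
  then have "finite E"
    by (rule finite_subset[rotated]) (auto simp: E_def)
  ultimately have "Suc m \<le> card E"
    using card_inj_on_le[of g "{..m}" E] by simp
  moreover have "card E \<le> m"
  proof -
    have "\<exists>a\<in>A i. d i a = 0" for i
    proof -
      have "Min ((\<lambda>a. h i a z) ` A i) \<in> (\<lambda>a. h i a z) ` A i"
        using A by (intro Min_in) auto
      moreover have "z $ i = Min ((\<lambda>a. h i a z) ` A i)"
        using arg_cong[OF z, of "\<lambda>v. v $ i"] by (simp add: F_def)
      ultimately show ?thesis
        by (auto simp: d_def)
    qed
    then obtain opt where opt: "\<And>i. opt i \<in> A i" "\<And>i. d i (opt i) = 0"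
      by metis
    define Opt where "Opt = range (\<lambda>i. (i, opt i))"
    have "card Opt = CARD('n)"
      by (simp add: Opt_def card_image inj_on_def)
    moreover have "E \<inter> Opt = {}" "E \<union> Opt \<subseteq> (SIGMA i:UNIV. A i)"
      using opt by (auto simp: E_def Opt_def)
    then have "card E + card Opt \<le> card (SIGMA i:UNIV. A i)"
      using \<open>finite E\<close> fin by (metis card_Un_disjoint card_mono finite_Un finite_subset)
    ultimately show ?thesis
      by (simp add: m_def)
  qed
  ultimately show False
    by simp
qed

section \<open>Reduction of the mean-payoff game to a discounted game\<close>

text \<open>Adding \<eta>\<theta> to both sides of v = f v - \<eta> gives w = f v + \<eta>(\<theta>
  - 1), where \<eta> and v are read off from w through \<open>v $ c = 0\<close>.\<close>

definition discounted ::
  "real^'n \<Rightarrow> 'n \<Rightarrow> (real^'n \<Rightarrow> real^'n) \<Rightarrow> real^'n \<Rightarrow> real^'n" where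
  "discounted \<theta> c f w =
     f (w - (w $ c / \<theta> $ c) *\<^sub>R \<theta>) + (w $ c / \<theta> $ c) *\<^sub>R (\<theta> - 1)"

lemma discounted_add_scaleR:
  assumes "v $ c = 0" "\<theta> $ c \<noteq> 0"
  shows "discounted \<theta> c f (v + \<eta> *\<^sub>R \<theta>) = f v + \<eta> *\<^sub>R (\<theta> - 1)"
  using assms by (simp add: discounted_def)

lemma discounted_fixed_point:
  assumes "vec \<eta> + v = f v" "v $ c = 0" "\<theta> $ c \<noteq> 0"
  shows "discounted \<theta> c f (v + \<eta> *\<^sub>R \<theta>) = v + \<eta> *\<^sub>R \<theta>"
  by (simp add: discounted_add_scaleR assms(2,3) assms(1)[symmetric] vec_eq_iff algebra_simps)

lemma ex_eigen_solution:
  assumes "contracting \<theta> (discounted \<theta> c f)"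
  shows "\<exists>\<eta> v. vec \<eta> + v = f v \<and> v $ c = 0"
proof -
  obtain w where w: "discounted \<theta> c f w = w"
    using contracting_ex1_fixed_point[OF assms] by blast
  have "1 \<le> \<theta> $ c"
    using assms by (simp add: contracting_def)
  define \<eta> where "\<eta> = w $ c / \<theta> $ c"
  define v where "v = w - \<eta> *\<^sub>R \<theta>"
  have "v $ c = 0"
    using \<open>1 \<le> \<theta> $ c\<close> by (simp add: v_def \<eta>_def)
  moreover have w_eq: "w = v + \<eta> *\<^sub>R \<theta>"
    by (simp add: v_def)
  ultimately have "f v + \<eta> *\<^sub>R (\<theta> - 1) = v + \<eta> *\<^sub>R \<theta>"
    using w \<open>1 \<le> \<theta> $ c\<close> discounted_add_scaleR[of v c \<theta> f \<eta>] by simp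
  then have "vec \<eta> + v = f v"
    by (simp add: vec_eq_iff algebra_simps)
  with \<open>v $ c = 0\<close> show ?thesis
    by blast
qed

section \<open>General properties of the policy iteration scheme\<close>

lemma pi_reaches_policy: "pi_reaches Pol f fp evl s p \<Longrightarrow> p \<in> Pol"
  by (induction rule: pi_reaches.induct) (auto simp: improves_def)

lemma ex_improves:
  assumes "p \<in> Pol" "\<exists>p\<in>Pol. f v = fp p v"
  shows "\<exists>p'. improves Pol f fp p v p'"
  using assms by (cases "f v = fp p v") (auto simp: improves_def)

text \<open>At the largest counter that is ever reached, the improvement step can only keep the
  policy.\<close>

lemma ex_pi_returns:
  assumes stops: "pi_stops_within Pol f fp evl N" and "Pol \<noteq> {}"
  shows "\<exists>s \<eta> v p. pi_returns Pol f fp evl s \<eta> v p"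
proof -
  define R where "R = {s. \<exists>p. pi_reaches Pol f fp evl s p}"
  have "R \<subseteq> {..N}"
    using stops by (auto simp: R_def pi_stops_within_def)
  then have "finite R"
    by (rule finite_subset) simp
  moreover have "R \<noteq> {}"
    using \<open>Pol \<noteq> {}\<close> by (auto simp: R_def intro: pi_reaches.init)
  ultimately have "Max R \<in> R"
    by (rule Max_in)
  then obtain p where p: "pi_reaches Pol f fp evl (Max R) p"
    by (auto simp: R_def)
  obtain \<eta> v where v: "evl p \<eta> v"
    using stops p unfolding pi_stops_within_def by blast
  obtain p' where p': "improves Pol f fp p v p'"
    using stops p v unfolding pi_stops_within_def by blast
  have "p' = p"
  proof (rule ccontr)
    assume "p' \<noteq> p"
    then have "Suc (Max R) \<in> R"
      using pi_reaches.step[OF p v p'] by (auto simp: R_def)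
    then show False
      using Max_ge[OF \<open>finite R\<close>] by fastforce
  qed
  then show ?thesis
    using p v p' by (auto simp: pi_returns_def)
qed

text \<open>The counting argument needs whole runs. Since \<open>improves\<close> keeps the old
  policy whenever possible, a change of policy means that the old one does not attain
  \<open>f (v t)\<close>.\<close>

lemma pi_reaches_history:
  assumes "pi_reaches Pol f fp evl s p"
  shows "\<exists>\<sigma> \<eta> v. \<sigma> s = p \<and> (\<forall>t\<le>s. \<sigma> t \<in> Pol) \<and>
    (\<forall>t<s. evl (\<sigma> t) (\<eta> t) (v t) \<and> fp (\<sigma> (Suc t)) (v t) = f (v t) \<and> f (v t) \<noteq> fp (\<sigma> t) (v t))"
  using assms
proof (induction rule: pi_reaches.induct)
  case (init p)
  then show ?case
    by (intro exI[of _ "\<lambda>_. p"]) simp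
next
  case (step s p \<eta>1 v1 p')
  from step.IH obtain \<sigma> \<eta> v where IH: "\<sigma> s = p" "\<forall>t\<le>s. \<sigma> t \<in> Pol"
    "\<forall>t<s. evl (\<sigma> t) (\<eta> t) (v t) \<and> fp (\<sigma> (Suc t)) (v t) = f (v t) \<and> f (v t) \<noteq> fp (\<sigma> t) (v t)"
    by blast
  have last: "evl p \<eta>1 v1" "p' \<in> Pol" "fp p' v1 = f v1" "f v1 \<noteq> fp p v1"
    using step.hyps by (auto simp: improves_def)
  show ?case
    by (rule exI[of _ "\<sigma>(Suc s := p')"], rule exI[of _ "\<eta>(s := \<eta>1)"], rule exI[of _ "v(s := v1)"])
       (use IH last in \<open>simp add: less_Suc_eq le_Suc_eq\<close>)
qed

lemma increasing_policy_iteration_stops: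
  fixes f :: "real^'n \<Rightarrow> real^'n"
  assumes fin: "finite (fp ` Pol)"
    and contr: "\<And>p. p \<in> Pol \<Longrightarrow> contracting \<theta> (discounted \<theta> c (fp p))"
    and le: "\<And>p v. p \<in> Pol \<Longrightarrow> fp p v \<le> f v"
    and att: "\<And>v. \<exists>p\<in>Pol. f v = fp p v"
  shows "\<exists>N. pi_stops_within Pol f fp (eigen_solution c fp) N"
proof -
  define val where "val g = (THE w. discounted \<theta> c g w = w)" for g
  define V where "V = val ` fp ` Pol"
  have "finite V"
    using fin by (simp add: V_def)
  have val: "discounted \<theta> c (fp p) w = w \<longleftrightarrow> w = val (fp p)" if "p \<in> Pol" for p w
    using theI'[OF contracting_ex1_fixed_point[OF contr[OF that]]]
      the1_equality[OF contracting_ex1_fixed_point[OF contr[OF that]], of w]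
    unfolding val_def by auto
  have increase: "val (fp p) < val (fp p')"
    if p: "p \<in> Pol" "p' \<in> Pol" and evl: "eigen_solution c fp p \<eta> v"
      and eq: "f v = fp p' v" and neq: "f v \<noteq> fp p v" for p p' \<eta> v
  proof -
    have \<theta>: "\<theta> $ c \<noteq> 0"
      using contr[OF p(1)] by (auto simp: contracting_def dest: spec[of _ c])
    have v: "vec \<eta> + v = fp p v" "v $ c = 0"
      using evl by (auto simp: eigen_solution_def)
    have w: "v + \<eta> *\<^sub>R \<theta> = val (fp p)"
      using val[OF p(1)] discounted_fixed_point[of \<eta> v "fp p", OF v \<theta>] by blast
    have D: "discounted \<theta> c (fp q) (val (fp p)) = fp q v + \<eta> *\<^sub>R (\<theta> - 1)" for q
      unfolding w[symmetric] by (rule discounted_add_scaleR[OF v(2) \<theta>])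
    have fixp: "discounted \<theta> c (fp q) (val (fp q)) = val (fp q)" if "q \<in> Pol" for q
      using val[OF that] by blast
    have "discounted \<theta> c (fp p) (val (fp p)) \<le> discounted \<theta> c (fp p') (val (fp p))"
      unfolding D using le[OF p(1), of v] eq by simp
    then have "val (fp p) \<le> discounted \<theta> c (fp p') (val (fp p))"
      by (simp add: fixp p)
    then have "val (fp p) \<le> val (fp p')"
      by (rule contracting_le[OF contr[OF p(2)]]) (simp add: fixp p)
    \<comment> \<open>With equal values both transformed maps agree there; cancelling
      \<eta>(\<theta> - 1) yields \<open>fp p' v = fp p v\<close>, against
      \<open>neq\<close>.\<close>
    moreover have "val (fp p) \<noteq> val (fp p')"
    proof
      assume "val (fp p) = val (fp p')"
      then have "discounted \<theta> c (fp p') (val (fp p)) = discounted \<theta> c (fp p) (val (fp p))"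
        using fixp[OF p(1)] fixp[OF p(2)] by simp
      then show False
        unfolding D using eq neq by simp
    qed
    ultimately show ?thesis
      by simp
  qed
  \<comment> \<open>The potential is the number of values strictly below the current one; an
    increase adds at least the old value to them.\<close>
  have bound: "s \<le> card {x \<in> V. x < val (fp p)}"
    if "pi_reaches Pol f fp (eigen_solution c fp) s p" for s p
    using that
  proof (induction rule: pi_reaches.induct)
    case (step s p \<eta> v p')
    have p: "p \<in> Pol" "p' \<in> Pol"
      using pi_reaches_policy[OF step.hyps(1)] step.hyps(3) by (auto simp: improves_def)
    have lt: "val (fp p) < val (fp p')"
      using step.hyps(2-4) by (intro increase p) (auto simp: improves_def)
    have "{x \<in> V. x < val (fp p)} \<subset> {x \<in> V. x < val (fp p')}"
      using lt p by (auto simp: V_def)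
    then have "card {x \<in> V. x < val (fp p)} < card {x \<in> V. x < val (fp p')}"
      using \<open>finite V\<close> by (intro psubset_card_mono) auto
    then show ?case
      using step.IH by simp
  qed simp
  have "s \<le> card V" if "pi_reaches Pol f fp (eigen_solution c fp) s p" for s p
    using bound[OF that] card_mono[OF \<open>finite V\<close>, of "{x \<in> V. x < val (fp p)}"] by auto
  moreover have "\<exists>\<eta> v. eigen_solution c fp p \<eta> v" if "p \<in> Pol" for p
    using ex_eigen_solution[OF contr[OF that]] by (simp add: eigen_solution_def)
  ultimately show ?thesis
    unfolding pi_stops_within_def
    by (intro exI[of _ "card V"] allI impI conjI ex_improves att) (blast dest: pi_reaches_policy)+
qed

text \<open>Return times enter only through the Bellman inequality \<open>\<theta>_ge\<close>; the
  final theorem supplies such a \<theta>.\<close>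

locale discountable_game =
  fixes A :: "'n::finite \<Rightarrow> 'a set"
    and B :: "'n \<Rightarrow> 'b set"
    and M :: "'n \<Rightarrow> 'a \<Rightarrow> 'b \<Rightarrow> 'n \<Rightarrow> real"
    and r :: "'n \<Rightarrow> 'a \<Rightarrow> 'b \<Rightarrow> real"
    and c :: 'n
    and \<theta> :: "real^'n"
  assumes finite_A: "finite (A i)" and A_ne: "A i \<noteq> {}"
    and finite_B: "finite (B i)" and B_ne: "B i \<noteq> {}"
    and M_nonneg: "a \<in> A i \<Longrightarrow> b \<in> B i \<Longrightarrow> 0 \<le> M i a b j"
    and \<theta>_ge1: "1 \<le> \<theta> $ i"
    and \<theta>_ge: "a \<in> A i \<Longrightarrow> b \<in> B i \<Longrightarrow> 1 + (\<Sum>j\<in>- {c}. M i a b j * \<theta> $ j) \<le> \<theta> $ i"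
begin

definition gain :: "'n \<Rightarrow> 'a \<Rightarrow> 'b \<Rightarrow> real^'n \<Rightarrow> real" where
  "gain i a b v = (\<Sum>j\<in>UNIV. M i a b j * v $ j) + r i a b"

definition max_gain :: "'n \<Rightarrow> 'a \<Rightarrow> real^'n \<Rightarrow> real" where
  "max_gain i a v = Max ((\<lambda>b. gain i a b v) ` B i)"

abbreviation \<eta>_of :: "real^'n \<Rightarrow> real" where
  "\<eta>_of w \<equiv> w $ c / \<theta> $ c"

abbreviation v_of :: "real^'n \<Rightarrow> real^'n" where
  "v_of w \<equiv> w - \<eta>_of w *\<^sub>R \<theta>"

lemma \<theta>_pos: "0 < \<theta> $ i"
  using \<theta>_ge1[of i] by simp

lemma f_pair_nth: "f_pair M r \<sigma> \<delta> v $ i = gain i (\<sigma> i) (\<delta> (i, \<sigma> i)) v"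
  by (simp add: f_pair_def gain_def matrix_vector_mult_def policy_matrix_def policy_reward_def)

lemma selection_B:
  obtains \<beta> where "\<And>i. \<beta> i \<in> B i"
proof -
  have "\<forall>i. \<exists>b. b \<in> B i"
    using B_ne by auto
  then show thesis
    using that by metis
qed

text \<open>Coordinate \<open>i\<close> sees \<delta> only at \<open>(i, \<sigma> i)\<close>, and
  any action there extends to a full policy.\<close>

lemma f_min_policy_nth: "f_min_policy B M r \<sigma> v $ i = max_gain i (\<sigma> i) v"
proof -
  have "(\<lambda>\<delta>. f_pair M r \<sigma> \<delta> v $ i) ` max_policies B = (\<lambda>b. gain i (\<sigma> i) b v) ` B i"
  proof (intro equalityI image_subsetI)
    fix b assume "b \<in> B i"
    obtain \<beta> where "\<And>k. \<beta> k \<in> B k"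
      using selection_B by blast
    then have "(\<lambda>(k, a). if k = i then b else \<beta> k) \<in> max_policies B"
      using \<open>b \<in> B i\<close> by (simp add: max_policies_def)
    then show "gain i (\<sigma> i) b v \<in> (\<lambda>\<delta>. f_pair M r \<sigma> \<delta> v $ i) ` max_policies B"
      by (rule rev_image_eqI) (simp add: f_pair_nth)
  qed (auto simp: f_pair_nth max_policies_def)
  then show ?thesis
    by (simp add: f_min_policy_def max_gain_def)
qed

lemma f_game_nth: "f_game A B M r v $ i = Min ((\<lambda>a. max_gain i a v) ` A i)"
  by (simp add: f_game_def max_gain_def gain_def)

text \<open>In the variable \<open>w = v + \<eta>\<theta>\<close> the coefficient of \<open>w $ c / \<theta> $ c\<close> is
  \<open>\<theta> $ i - 1 - (\<Sum>j\<in>- {c}. M i a b j * \<theta> $ j)\<close>, which is nonnegative.\<close>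

lemma shrinking_gain:
  assumes ab: "a \<in> A i" "b \<in> B i"
  shows "shrinking \<theta> (\<theta> $ i - 1) (\<lambda>w. gain i a b (v_of w) + \<eta>_of w * (\<theta> $ i - 1))"
  unfolding shrinking_def
proof (intro allI impI)
  fix v w :: "real^'n" and t :: real
  assume "0 \<le> t" and "v \<le> w + t *\<^sub>R \<theta>"
  then have le: "v $ j \<le> w $ j + t * \<theta> $ j" for j
    by (simp add: less_eq_vec_def)
  define s where "s = (\<Sum>j\<in>- {c}. M i a b j * \<theta> $ j)"
  have s: "0 \<le> \<theta> $ i - 1 - s"
    using \<theta>_ge[OF ab] by (simp add: s_def)
  have expand: "gain i a b (v_of w) + \<eta>_of w * (\<theta> $ i - 1)
      = (\<Sum>j\<in>- {c}. M i a b j * w $ j) + r i a b + \<eta>_of w * (\<theta> $ i - 1 - s)" for w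
  proof -
    have "(\<Sum>j\<in>UNIV. M i a b j * v_of w $ j) = (\<Sum>j\<in>- {c}. M i a b j * v_of w $ j)"
      using \<theta>_pos[of c] by (intro sum.mono_neutral_right) auto
    also have "\<dots> = (\<Sum>j\<in>- {c}. M i a b j * w $ j) - \<eta>_of w * s"
      by (simp add: s_def sum_distrib_left right_diff_distrib sum_subtractf mult_ac)
    finally have *: "(\<Sum>j\<in>UNIV. M i a b j * v_of w $ j) = (\<Sum>j\<in>- {c}. M i a b j * w $ j) - \<eta>_of w * s" .
    show ?thesis
      unfolding gain_def * by (simp add: right_diff_distrib)
  qed
  have "(\<Sum>j\<in>- {c}. M i a b j * v $ j) \<le> (\<Sum>j\<in>- {c}. M i a b j * (w $ j + t * \<theta> $ j))"
    using M_nonneg[OF ab] le by (intro sum_mono mult_left_mono) auto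
  also have "\<dots> = (\<Sum>j\<in>- {c}. M i a b j * w $ j) + t * s"
    by (simp add: s_def sum_distrib_left distrib_left sum.distrib mult_ac)
  finally have 1: "(\<Sum>j\<in>- {c}. M i a b j * v $ j) \<le> (\<Sum>j\<in>- {c}. M i a b j * w $ j) + t * s" .
  \<comment> \<open>The increments \<open>t * s\<close> from the transitions and
    \<open>t * (\<theta> $ i - 1 - s)\<close> from \<eta> add up to exactly
    \<open>t * (\<theta> $ i - 1)\<close>.\<close>
  have "\<eta>_of v \<le> \<eta>_of w + t"
    using le[of c] \<theta>_pos[of c] by (simp add: field_simps)
  then have "\<eta>_of v * (\<theta> $ i - 1 - s) \<le> (\<eta>_of w + t) * (\<theta> $ i - 1 - s)"
    using s by (rule mult_right_mono)
  with 1 show "gain i a b (v_of v) + \<eta>_of v * (\<theta> $ i - 1)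
      \<le> gain i a b (v_of w) + \<eta>_of w * (\<theta> $ i - 1) + t * (\<theta> $ i - 1)"
    unfolding expand by (simp add: algebra_simps)
qed

lemma shrinking_max_gain:
  assumes "a \<in> A i"
  shows "shrinking \<theta> (\<theta> $ i - 1) (\<lambda>w. max_gain i a (v_of w) + \<eta>_of w * (\<theta> $ i - 1))"
proof -
  have "max_gain i a (v_of w) + \<eta>_of w * (\<theta> $ i - 1)
      = Max ((\<lambda>b. gain i a b (v_of w) + \<eta>_of w * (\<theta> $ i - 1)) ` B i)" for w
    unfolding max_gain_def by (rule Max_add_commute[OF finite_B B_ne, symmetric])
  then show ?thesis
    using shrinking_Max[OF finite_B B_ne shrinking_gain[OF assms]] by simp
qed

lemma contracting_f_pair:
  assumes "\<sigma> \<in> min_policies A" "\<delta> \<in> max_policies B"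
  shows "contracting \<theta> (discounted \<theta> c (f_pair M r \<sigma> \<delta>))"
  using assms shrinking_gain \<theta>_ge1
  by (auto simp: contracting_def discounted_def f_pair_nth min_policies_def max_policies_def)

lemma internal_iteration_stops:
  assumes \<sigma>: "\<sigma> \<in> min_policies A"
  shows "\<exists>N. pi_stops_within (max_policies B) (f_min_policy B M r \<sigma>) (f_pair M r \<sigma>)
           (eigen_solution c (f_pair M r \<sigma>)) N"
proof (rule increasing_policy_iteration_stops)
  \<comment> \<open>The type \<open>'a\<close>, hence also \<open>max_policies B\<close>, may be infinite, but only the values
    \<open>\<delta> (i, \<sigma> i)\<close> matter.\<close>
  have "f_pair M r \<sigma> ` (max_policies B :: ('n \<times> 'a \<Rightarrow> 'b) set)
      \<subseteq> (\<lambda>\<beta> v. \<chi> i. gain i (\<sigma> i) (\<beta> i) v) ` (PiE UNIV B)"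
  proof (rule image_subsetI)
    fix \<delta> :: "'n \<times> 'a \<Rightarrow> 'b"
    assume "\<delta> \<in> max_policies B"
    then have "(\<lambda>i. \<delta> (i, \<sigma> i)) \<in> PiE UNIV B"
      by (simp add: max_policies_def PiE_iff)
    then show "f_pair M r \<sigma> \<delta> \<in> (\<lambda>\<beta> v. \<chi> i. gain i (\<sigma> i) (\<beta> i) v) ` (PiE UNIV B)"
      by (rule rev_image_eqI) (simp add: fun_eq_iff vec_eq_iff f_pair_nth)
  qed
  then show "finite (f_pair M r \<sigma> ` max_policies B)"
    by (rule finite_subset) (simp add: finite_PiE finite_B)
  show "contracting \<theta> (discounted \<theta> c (f_pair M r \<sigma> \<delta>))" if "\<delta> \<in> max_policies B" for \<delta>
    using contracting_f_pair[OF \<sigma> that] .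
  show "f_pair M r \<sigma> \<delta> v \<le> f_min_policy B M r \<sigma> v" if "\<delta> \<in> max_policies B" for \<delta> v
    using that finite_B
    by (auto simp: less_eq_vec_def f_pair_nth f_min_policy_nth max_gain_def max_policies_def)
  show "\<exists>\<delta>\<in>max_policies B. f_min_policy B M r \<sigma> v = f_pair M r \<sigma> \<delta> v" for v
  proof -
    have "max_gain i (\<sigma> i) v \<in> (\<lambda>b. gain i (\<sigma> i) b v) ` B i" for i
      unfolding max_gain_def using finite_B B_ne by (intro Max_in) auto
    then have "\<forall>i. \<exists>b. b \<in> B i \<and> max_gain i (\<sigma> i) v = gain i (\<sigma> i) b v"
      by blast
    then obtain \<beta> where \<beta>: "\<And>i. \<beta> i \<in> B i" "\<And>i. max_gain i (\<sigma> i) v = gain i (\<sigma> i) (\<beta> i) v"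
      by metis
    then show ?thesis
      by (intro bexI[of _ "\<lambda>(i, a). \<beta> i"])
         (simp_all add: vec_eq_iff f_pair_nth f_min_policy_nth max_policies_def)
  qed
qed

lemma ex_hk_eval:
  assumes "\<sigma> \<in> min_policies A"
  shows "\<exists>\<eta> v. hk_eval B M r c \<sigma> \<eta> v"
proof -
  have "(max_policies B :: ('n \<times> 'a \<Rightarrow> 'b) set) \<noteq> {}"
  proof -
    obtain \<beta> where "\<And>k. \<beta> k \<in> B k"
      using selection_B by blast
    then have "(\<lambda>(k, a). \<beta> k) \<in> max_policies B"
      by (simp add: max_policies_def)
    then show ?thesis by blast
  qed
  then show ?thesis
    using internal_iteration_stops[OF assms] ex_pi_returns unfolding hk_eval_def by metis
qed

text \<open>The internal run returns when its policy \<delta> attains the maximum at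
  \<open>v\<close>, so the exact solution for \<delta> also solves the problem for \<sigma>.\<close>

lemma hk_eval_eigen_solution:
  assumes "hk_eval B M r c \<sigma> \<eta> v"
  shows "vec \<eta> + v = f_min_policy B M r \<sigma> v" "v $ c = 0"
  using assms by (auto simp: hk_eval_def pi_returns_def eigen_solution_def improves_def)

lemma external_iterations_le:
  assumes K: "\<And>i. \<theta> $ i \<le> K" and L: "1 \<le> L" "K * (1 - 1 / K) ^ L < 1"
    and reach: "pi_reaches (min_policies A) (f_game A B M r) (f_min_policy B M r) (hk_eval B M r c) s \<sigma>"
  shows "s \<le> (card (SIGMA i:UNIV. A i) - CARD('n)) * L"
proof -
  obtain \<sigma>s \<eta>' v' where "\<sigma>s s = \<sigma>" and all_\<sigma>: "\<forall>t\<le>s. \<sigma>s t \<in> min_policies A"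
    and hist: "\<forall>t<s. hk_eval B M r c (\<sigma>s t) (\<eta>' t) (v' t) \<and>
      f_min_policy B M r (\<sigma>s (Suc t)) (v' t) = f_game A B M r (v' t) \<and>
      f_game A B M r (v' t) \<noteq> f_min_policy B M r (\<sigma>s t) (v' t)"
    using pi_reaches_history[OF reach] by blast
  have \<sigma>s: "\<sigma>s t \<in> min_policies A" if "t \<le> s" for t
    using all_\<sigma> that by blast
  \<comment> \<open>The history ends before the policy at counter \<open>s\<close> is evaluated; one
    more evaluation provides \<open>w s\<close>.\<close>
  obtain \<eta>'' v'' where last: "hk_eval B M r c (\<sigma>s s) \<eta>'' v''"
    using ex_hk_eval[OF \<sigma>s[OF order_refl]] by blast
  define \<eta> where "\<eta> = \<eta>'(s := \<eta>'')"
  define v where "v = v'(s := v'')"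
  have evl: "hk_eval B M r c (\<sigma>s t) (\<eta> t) (v t)" if "t \<le> s" for t
    using hist last that by (auto simp: \<eta>_def v_def)
  have eq: "f_game A B M r (v t) = f_min_policy B M r (\<sigma>s (Suc t)) (v t)" if "t < s" for t
    using hist that by (simp add: v_def)
  have neq: "f_game A B M r (v t) \<noteq> f_min_policy B M r (\<sigma>s t) (v t)" if "t < s" for t
    using hist that by (simp add: v_def)
  have \<theta>: "\<theta> $ c \<noteq> 0"
    using \<theta>_pos[of c] by simp
  note eigen = hk_eval_eigen_solution[OF evl]
  define h where "h i a w = max_gain i a (v_of w) + \<eta>_of w * (\<theta> $ i - 1)" for i a w
  define w where "w t = v t + \<eta> t *\<^sub>R \<theta>" for t
  have policy: "(\<chi> i. h i (\<tau> i) x) = discounted \<theta> c (f_min_policy B M r \<tau>) x" for \<tau> x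
    by (simp add: vec_eq_iff h_def discounted_def f_min_policy_nth)
  have "Min ((\<lambda>a. h i a x) ` A i) = Min ((\<lambda>a. max_gain i a (v_of x)) ` A i) + \<eta>_of x * (\<theta> $ i - 1)"
    for i x
    unfolding h_def by (rule Min_add_commute[OF finite_A A_ne])
  then have game: "(\<chi> i. Min ((\<lambda>a. h i a x) ` A i)) = discounted \<theta> c (f_game A B M r) x" for x
    by (simp add: vec_eq_iff discounted_def f_game_nth)
  have at_w: "discounted \<theta> c g (w t) = g (v t) + \<eta> t *\<^sub>R (\<theta> - 1)" if "t \<le> s" for g t
    unfolding w_def by (rule discounted_add_scaleR[OF eigen(2)[OF that] \<theta>])
  have fixp: "discounted \<theta> c (f_min_policy B M r (\<sigma>s t)) (w t) = w t" if "t \<le> s" for t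
    unfolding w_def by (rule discounted_fixed_point[where f="f_min_policy B M r (\<sigma>s t)", OF eigen[OF that] \<theta>])
  show ?thesis
  proof (rule policy_iteration_length_le[where h=h and \<sigma>=\<sigma>s and w=w and \<theta>=\<theta> and K=K])
    show "shrinking \<theta> (\<theta> $ i - 1) (h i a)" if "a \<in> A i" for i a
      unfolding h_def[abs_def] by (rule shrinking_max_gain[OF that])
    show "(\<chi> i. h i (\<sigma>s t i) (w t)) = w t" if "t \<le> s" for t
      unfolding policy by (rule fixp[OF that])
    show "(\<chi> i. h i (\<sigma>s (Suc t) i) (w t)) = (\<chi> i. Min ((\<lambda>a. h i a (w t)) ` A i))" if "t < s" for t
      unfolding policy game using at_w[of t] that eq[OF that] by simp
    show "(\<chi> i. Min ((\<lambda>a. h i a (w t)) ` A i)) \<noteq> w t" if "t < s" for t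
    proof
      assume "(\<chi> i. Min ((\<lambda>a. h i a (w t)) ` A i)) = w t"
      then have "discounted \<theta> c (f_game A B M r) (w t)
          = discounted \<theta> c (f_min_policy B M r (\<sigma>s t)) (w t)"
        unfolding game using fixp[of t] that by simp
      then show False
        using at_w[of t] that neq[OF that] by simp
    qed
  qed (use finite_A A_ne \<theta>_ge1 K L \<sigma>s in auto)
qed

lemma hk_stops_within_mult:
  assumes "\<And>i. \<theta> $ i \<le> K" "1 \<le> L" "K * (1 - 1 / K) ^ L < 1"
  shows "hk_stops_within A B M r c ((card (SIGMA i:UNIV. A i) - CARD('n)) * L)"
proof -
  have "\<exists>\<sigma>\<in>min_policies A. f_game A B M r v = f_min_policy B M r \<sigma> v" for v
  proof -
    have "Min ((\<lambda>a. max_gain i a v) ` A i) \<in> (\<lambda>a. max_gain i a v) ` A i" for i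
      using finite_A A_ne by (intro Min_in) auto
    then have "\<forall>i. \<exists>a. a \<in> A i \<and> Min ((\<lambda>a. max_gain i a v) ` A i) = max_gain i a v"
      by blast
    then obtain \<sigma> where "\<And>i. \<sigma> i \<in> A i" "\<And>i. Min ((\<lambda>a. max_gain i a v) ` A i) = max_gain i (\<sigma> i) v"
      by metis
    then show ?thesis
      by (intro bexI[of _ \<sigma>]) (simp_all add: vec_eq_iff f_game_nth f_min_policy_nth min_policies_def)
  qed
  then show ?thesis
    unfolding hk_stops_within_def pi_stops_within_def[of "min_policies A"]
    by (intro allI impI conjI external_iterations_le[OF assms] ex_hk_eval ex_improves
        internal_iteration_stops) (blast dest: pi_reaches_policy)+
qed

end

section \<open>The maximal return times and the iteration bound\<close>

lemma policy_matrix_nth: "policy_matrix M \<sigma> \<delta> $ i $ j = M i (\<sigma> i) (\<delta> (i, \<sigma> i)) j"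
  by (simp add: policy_matrix_def)

lemma row_stochastic_policy_matrix:
  assumes "\<And>i a b j. a \<in> A i \<Longrightarrow> b \<in> B i \<Longrightarrow> 0 \<le> M i a b j"
    and "\<And>i a b. a \<in> A i \<Longrightarrow> b \<in> B i \<Longrightarrow> (\<Sum>j\<in>UNIV. M i a b j) = 1"
    and "\<sigma> \<in> min_policies A" "\<delta> \<in> max_policies B"
  shows "row_stochastic (policy_matrix M \<sigma> \<delta>)"
  using assms by (simp add: row_stochastic_def policy_matrix_def min_policies_def max_policies_def)

text \<open>Makes \<open>Max\<close> in \<open>max_return_time\<close> range over a finite set of
  values: the matrix depends on \<delta> only through the actions
  \<open>\<delta> (i, \<sigma> i)\<close>.\<close>

lemma finite_policy_matrices:
  fixes A :: "'n::finite \<Rightarrow> 'a set"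
  assumes "\<And>i. finite (A i)" "\<And>i. finite (B i)"
  shows "finite ((\<lambda>(\<sigma>, \<delta>). policy_matrix M \<sigma> \<delta>) ` (min_policies A \<times> max_policies B))"
proof -
  have "(\<lambda>(\<sigma>, \<delta>). policy_matrix M \<sigma> \<delta>) ` (min_policies A \<times> max_policies B)
      \<subseteq> (\<lambda>(\<alpha>, \<beta>). \<chi> i j. M i (\<alpha> i) (\<beta> i) j) ` (PiE UNIV A \<times> PiE UNIV B)"
  proof clarify
    fix \<sigma> and \<delta> :: "'n \<times> 'a \<Rightarrow> 'b"
    assume "\<sigma> \<in> min_policies A" "\<delta> \<in> max_policies B"
    then have "(\<sigma>, \<lambda>i. \<delta> (i, \<sigma> i)) \<in> PiE UNIV A \<times> PiE UNIV B"
      by (simp add: min_policies_def max_policies_def PiE_iff)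
    then show "policy_matrix M \<sigma> \<delta> \<in> (\<lambda>(\<alpha>, \<beta>). \<chi> i j. M i (\<alpha> i) (\<beta> i) j) ` (PiE UNIV A \<times> PiE UNIV B)"
      by (rule rev_image_eqI) (simp add: policy_matrix_def)
  qed
  then show ?thesis
    by (rule finite_subset) (simp add: finite_PiE assms)
qed

text \<open>A policy pair maximising the sum of the return times satisfies the Bellman inequality: were it
  violated at a single pair of actions, switching to these actions would not decrease any return
  time and would increase one of them.\<close>

lemma ex_return_time_bellman:
  fixes A :: "'n::finite \<Rightarrow> 'a set" and B :: "'n \<Rightarrow> 'b set"
    and M :: "'n \<Rightarrow> 'a \<Rightarrow> 'b \<Rightarrow> 'n \<Rightarrow> real" and c :: 'n
  defines "Pols \<equiv> min_policies A \<times> max_policies B"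
  defines "T \<equiv> \<lambda>(\<sigma>, \<delta>). \<chi> i. enn2real (return_time (policy_matrix M \<sigma> \<delta>) i c)"
  assumes A: "\<And>i. finite (A i)" "\<And>i. A i \<noteq> {}"
    and B: "\<And>i. finite (B i)" "\<And>i. B i \<noteq> {}"
    and stoch: "\<And>\<sigma> \<delta>. (\<sigma>, \<delta>) \<in> Pols \<Longrightarrow> row_stochastic (policy_matrix M \<sigma> \<delta>)"
    and acc: "\<And>\<sigma> \<delta> i. (\<sigma>, \<delta>) \<in> Pols \<Longrightarrow> accessible (policy_matrix M \<sigma> \<delta>) i c"
  obtains \<sigma> \<delta> where "(\<sigma>, \<delta>) \<in> Pols" "\<And>i. 1 \<le> T (\<sigma>, \<delta>) $ i"
    "\<And>i a b. a \<in> A i \<Longrightarrow> b \<in> B i \<Longrightarrow> 1 + (\<Sum>j\<in>- {c}. M i a b j * T (\<sigma>, \<delta>) $ j) \<le> T (\<sigma>, \<delta>) $ i"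
proof -
  have "T ` Pols = (\<lambda>P. \<chi> i. enn2real (return_time P i c)) ` (\<lambda>(\<sigma>, \<delta>). policy_matrix M \<sigma> \<delta>) ` Pols"
    by (auto simp: T_def image_image intro!: image_cong)
  then have fin: "finite (T ` Pols)"
    using finite_policy_matrices[of A B M] A B by (simp add: Pols_def)
  have "\<forall>i. \<exists>a. a \<in> A i" "\<forall>i. \<exists>b. b \<in> B i"
    using A(2) B(2) by (simp_all add: ex_in_conv)
  then obtain \<alpha> \<beta> where "\<And>i. \<alpha> i \<in> A i" "\<And>i. \<beta> i \<in> B i"
    by metis
  then have "(\<alpha>, \<lambda>(i, a). \<beta> i) \<in> Pols"
    by (simp add: Pols_def min_policies_def max_policies_def)
  then have ne: "T ` Pols \<noteq> {}"
    by blast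
  \<comment> \<open>The sum is strictly monotone for the coordinatewise order, so a maximiser is
    dominated by no other return time vector.\<close>
  define total where "total x = (\<Sum>i\<in>UNIV. x $ i)" for x :: "real^'n"
  have "Max (total ` T ` Pols) \<in> total ` T ` Pols"
    using fin ne by (intro Max_in) auto
  then obtain \<sigma> \<delta> where \<pi>: "(\<sigma>, \<delta>) \<in> Pols" and "total (T (\<sigma>, \<delta>)) = Max (total ` T ` Pols)"
    by force
  then have max: "total (T \<pi>) \<le> total (T (\<sigma>, \<delta>))" if "\<pi> \<in> Pols" for \<pi>
    using fin that by simp
  define row where "row \<sigma> \<delta> x = (\<chi> i. 1 + (\<Sum>j\<in>- {c}. M i (\<sigma> i) (\<delta> (i, \<sigma> i)) j * x $ j))"
    for \<sigma> and \<delta> :: "'n \<times> 'a \<Rightarrow> 'b" and x :: "real^'n"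
  have T: "row \<sigma> \<delta> (T (\<sigma>, \<delta>)) = T (\<sigma>, \<delta>)" if "(\<sigma>, \<delta>) \<in> Pols" for \<sigma> \<delta>
    unfolding vec_eq_iff
  proof
    fix i
    show "row \<sigma> \<delta> (T (\<sigma>, \<delta>)) $ i = T (\<sigma>, \<delta>) $ i"
      using enn2real_return_time_first_step[OF stoch[OF that] acc[OF that], of i]
      by (simp add: row_def T_def policy_matrix_nth)
  qed
  have nonneg: "0 \<le> M i (\<sigma> i) (\<delta> (i, \<sigma> i)) j" if "(\<sigma>, \<delta>) \<in> Pols" for \<sigma> \<delta> i j
    using stoch[OF that] by (simp add: row_stochastic_def policy_matrix_def)
  have T_ge1: "1 \<le> T (\<sigma>, \<delta>) $ i" if "(\<sigma>, \<delta>) \<in> Pols" for \<sigma> \<delta> i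
  proof -
    have "0 \<le> (\<Sum>j\<in>- {c}. M i (\<sigma> i) (\<delta> (i, \<sigma> i)) j * T (\<sigma>, \<delta>) $ j)"
      using nonneg[OF that] by (intro sum_nonneg mult_nonneg_nonneg) (simp_all add: T_def)
    then show ?thesis
      by (subst T[OF that, symmetric]) (simp add: row_def)
  qed
  \<comment> \<open>By the first-step equation the linear part of
    \<open>row \<sigma> \<delta>\<close> maps the return times T to exactly T - 1.\<close>
  have contr: "contracting (T (\<sigma>, \<delta>)) (row \<sigma> \<delta>)" if "(\<sigma>, \<delta>) \<in> Pols" for \<sigma> \<delta>
    unfolding contracting_def shrinking_def
  proof (intro conjI allI impI T_ge1[OF that])
    fix i t and v w :: "real^'n"
    assume "v \<le> w + t *\<^sub>R T (\<sigma>, \<delta>)"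
    then have "(\<Sum>j\<in>- {c}. M i (\<sigma> i) (\<delta> (i, \<sigma> i)) j * v $ j)
        \<le> (\<Sum>j\<in>- {c}. M i (\<sigma> i) (\<delta> (i, \<sigma> i)) j * (w $ j + t * T (\<sigma>, \<delta>) $ j))"
      using nonneg[OF that] by (intro sum_mono mult_left_mono) (auto simp: less_eq_vec_def)
    also have "\<dots> = (\<Sum>j\<in>- {c}. M i (\<sigma> i) (\<delta> (i, \<sigma> i)) j * w $ j)
        + t * (row \<sigma> \<delta> (T (\<sigma>, \<delta>)) $ i - 1)"
      by (simp add: row_def distrib_left sum.distrib sum_distrib_left mult_ac)
    finally show "row \<sigma> \<delta> v $ i \<le> row \<sigma> \<delta> w $ i + t * (T (\<sigma>, \<delta>) $ i - 1)"
      unfolding T[OF that] by (simp add: row_def)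
  qed
  have "1 + (\<Sum>j\<in>- {c}. M k a b j * T (\<sigma>, \<delta>) $ j) \<le> T (\<sigma>, \<delta>) $ k"
    if ab: "a \<in> A k" "b \<in> B k" for k a b
  proof (rule ccontr)
    assume less: "\<not> ?thesis"
    define \<sigma>' where "\<sigma>' = \<sigma>(k := a)"
    define \<delta>' where "\<delta>' = \<delta>((k, a) := b)"
    have \<pi>': "(\<sigma>', \<delta>') \<in> Pols"
      using \<pi> ab by (simp add: Pols_def min_policies_def max_policies_def \<sigma>'_def \<delta>'_def)
    have row': "row \<sigma>' \<delta>' x $ i = (if i = k then 1 + (\<Sum>j\<in>- {c}. M k a b j * x $ j) else row \<sigma> \<delta> x $ i)"
      for i x
      by (simp add: row_def \<sigma>'_def \<delta>'_def)
    \<comment> \<open>Only row \<open>k\<close> changes, and the assumed violation raises it: the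
      old return times form a subsolution for the new pair.\<close>
    have step: "T (\<sigma>, \<delta>) \<le> row \<sigma>' \<delta>' (T (\<sigma>, \<delta>))"
      using less by (auto simp: less_eq_vec_def row' T[OF \<pi>])
    have le: "T (\<sigma>, \<delta>) \<le> T (\<sigma>', \<delta>')"
      by (rule contracting_le[OF contr[OF \<pi>'] step]) (simp add: T[OF \<pi>'])
    then have "row \<sigma>' \<delta>' (T (\<sigma>, \<delta>)) \<le> T (\<sigma>', \<delta>')"
      using contracting_mono[OF contr[OF \<pi>'] le] by (simp add: T[OF \<pi>'])
    then have "row \<sigma>' \<delta>' (T (\<sigma>, \<delta>)) $ k \<le> T (\<sigma>', \<delta>') $ k"
      by (simp add: less_eq_vec_def)
    then have "T (\<sigma>, \<delta>) $ k < T (\<sigma>', \<delta>') $ k"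
      using less by (simp add: row')
    then have "total (T (\<sigma>, \<delta>)) < total (T (\<sigma>', \<delta>'))"
      unfolding total_def using le by (intro sum_strict_mono_ex1) (auto simp: less_eq_vec_def)
    then show False
      using max[OF \<pi>'] by simp
  qed
  then show thesis
    using that \<pi> T_ge1 by blast
qed

section \<open>The number L and the asymptotic estimate\<close>

lemma return_bound_power_less_one:
  fixes K :: real
  assumes "1 \<le> K"
  defines "L \<equiv> 1 + nat \<lfloor>if K = 1 then 0 else ln K / ln (K / (K - 1))\<rfloor>"
  shows "K * (1 - 1 / K) ^ L < 1"
proof (cases "K = 1")
  case True
  then show ?thesis by (simp add: L_def)
next
  case False
  then have K: "1 < K"
    using assms by simp
  then have "1 < K / (K - 1)"
    by (simp add: field_simps)
  then have pos: "0 < ln (K / (K - 1))"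
    by simp
  \<comment> \<open>One plus the floor exceeds the quotient strictly, which after exponentiation
    says that (K/(K - 1))^L > K.\<close>
  have "ln K / ln (K / (K - 1)) < real L"
    using False by (simp add: L_def) linarith
  then have "ln K < real L * ln (K / (K - 1))"
    using pos by (simp add: field_simps)
  also have "\<dots> = ln ((K / (K - 1)) ^ L)"
    using K by (simp add: ln_realpow)
  finally have "K < (K / (K - 1)) ^ L"
    using K by simp
  moreover have "(1 - 1 / K) ^ L = inverse ((K / (K - 1)) ^ L)"
    using K by (simp add: power_inverse[symmetric] field_simps)
  ultimately show ?thesis
    using K by (simp add: field_simps)
qed

text \<open>From ln(1 + x) \<le> x at x = -1/K one gets ln(K/(K - 1)) \<ge> 1/K. The threshold 3
  exceeds e, so K ln K \<ge> 1 and the summand 1 is absorbed by the factor 2.\<close>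

lemma s_max_le:
  assumes K: "3 \<le> K"
  shows "real (s_max m K) \<le> 2 * (real m * K * ln K)"
proof -
  have "ln (1 - 1 / K) \<le> - (1 / K)"
    using ln_add_one_self_le_self2[of "- (1 / K)"] K by simp
  moreover have "ln (K / (K - 1)) = - ln (1 - 1 / K)"
    using K by (simp add: ln_div[symmetric] ln_inverse[symmetric] field_simps)
  ultimately have ge: "1 / K \<le> ln (K / (K - 1))"
    by simp
  have "exp 1 \<le> K"
    using exp_le K by linarith
  then have lnK: "1 \<le> ln K"
    using K by (simp add: ln_ge_iff)
  have "ln K / ln (K / (K - 1)) \<le> ln K / (1 / K)"
    using ge lnK K by (intro divide_left_mono) auto
  then have q: "ln K / ln (K / (K - 1)) \<le> K * ln K"
    by (simp add: mult.commute)
  have "0 \<le> ln K / ln (K / (K - 1))"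
    using ge lnK K by (intro divide_nonneg_nonneg) (auto intro: order_trans[OF _ ge])
  then have "real (nat \<lfloor>ln K / ln (K / (K - 1))\<rfloor>) \<le> ln K / ln (K / (K - 1))"
    by linarith
  moreover have "1 \<le> K * ln K"
    using mult_mono[of 1 K 1 "ln K"] K lnK by simp
  ultimately have "1 + real (nat \<lfloor>ln K / ln (K / (K - 1))\<rfloor>) \<le> 2 * (K * ln K)"
    using q by linarith
  then have "real m * (1 + real (nat \<lfloor>ln K / ln (K / (K - 1))\<rfloor>)) \<le> real m * (2 * (K * ln K))"
    by (rule mult_left_mono) simp
  then show ?thesis
    using K by (simp add: s_max_def algebra_simps)
qed

text \<open>The factor \<open>top\<close> of the filter puts no restriction on \<open>m\<close>, so
  the constant is uniform in \<open>m\<close>.\<close>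

lemma s_max_bigo:
  "(\<lambda>(m, K). real (s_max m K)) \<in> O[top \<times>\<^sub>F at_top](\<lambda>(m, K). real m * K * ln K)"
proof (rule bigoI[where c=2])
  have "norm (case p of (m, K) \<Rightarrow> real (s_max m K))
      \<le> 2 * norm (case p of (m, K) \<Rightarrow> real m * K * ln K)" if "3 \<le> snd p" for p :: "nat \<times> real"
    using that s_max_le[of "snd p" "fst p"] abs_ge_self[of "real (fst p) * snd p * ln (snd p)"]
    by (auto simp: case_prod_beta)
  moreover have "\<forall>\<^sub>F p in top \<times>\<^sub>F at_top. 3 \<le> snd (p :: nat \<times> real)"
    by (rule eventually_compose_filterlim[OF eventually_ge_at_top filterlim_snd])
  ultimately show "\<forall>\<^sub>F p in top \<times>\<^sub>F at_top. norm (case p of (m, K) \<Rightarrow> real (s_max m K))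
      \<le> 2 * norm (case p of (m :: nat, K :: real) \<Rightarrow> real m * K * ln K)"
    by (rule eventually_mono[rotated])
qed

theorem corollary16:
  fixes A :: "'n::finite \<Rightarrow> 'a set"
    and B :: "'n \<Rightarrow> 'b set"
    and M :: "'n \<Rightarrow> 'a \<Rightarrow> 'b \<Rightarrow> 'n \<Rightarrow> real"
    and r :: "'n \<Rightarrow> 'a \<Rightarrow> 'b \<Rightarrow> real"
    and c :: 'n
  assumes "\<And>i. finite (A i) \<and> A i \<noteq> {}"
    and "\<And>i. finite (B i) \<and> B i \<noteq> {}"
    and "\<And>i a b j. a \<in> A i \<Longrightarrow> b \<in> B i \<Longrightarrow> 0 \<le> M i a b j"
    and "\<And>i a b. a \<in> A i \<Longrightarrow> b \<in> B i \<Longrightarrow> (\<Sum>j\<in>UNIV. M i a b j) = 1"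
    and "\<And>\<sigma> \<delta>. \<sigma> \<in> min_policies A \<Longrightarrow> \<delta> \<in> max_policies B \<Longrightarrow>
           \<exists>!C. final_class (policy_matrix M \<sigma> \<delta>) C"
    and "\<And>\<sigma> \<delta> C. \<sigma> \<in> min_policies A \<Longrightarrow> \<delta> \<in> max_policies B \<Longrightarrow>
           final_class (policy_matrix M \<sigma> \<delta>) C \<Longrightarrow> c \<in> C"
  shows "(\<forall>i. max_return_time A B M i c < \<infinity>)
    \<and> hk_stops_within A B M r c
        (s_max (card (SIGMA i:UNIV. A i) - CARD('n)) (return_bound A B M c))
    \<and> (\<lambda>(m, K). real (s_max m K)) \<in> O[top \<times>\<^sub>F at_top](\<lambda>(m, K). real m * K * ln K)"
proof -
  define Pols where "Pols = min_policies A \<times> (max_policies B :: ('n \<times> 'a \<Rightarrow> 'b) set)"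
  have stoch: "row_stochastic (policy_matrix M \<sigma> \<delta>)" if "(\<sigma>, \<delta>) \<in> Pols" for \<sigma> \<delta>
    using that row_stochastic_policy_matrix[of A B M, OF assms(3,4)] by (simp add: Pols_def)
  have acc: "accessible (policy_matrix M \<sigma> \<delta>) i c" if \<pi>: "(\<sigma>, \<delta>) \<in> Pols" for \<sigma> \<delta> i
    using \<pi> assms(6) by (intro accessible_if_in_final_classes) (auto simp: Pols_def)
  obtain \<sigma> \<delta> where \<pi>: "(\<sigma>, \<delta>) \<in> Pols"
    and ge1: "\<And>i. 1 \<le> (\<chi> i. enn2real (return_time (policy_matrix M \<sigma> \<delta>) i c)) $ i"
    and ge: "\<And>i a b. a \<in> A i \<Longrightarrow> b \<in> B i \<Longrightarrow>
      1 + (\<Sum>j\<in>- {c}. M i a b j * (\<chi> i. enn2real (return_time (policy_matrix M \<sigma> \<delta>) i c)) $ j)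
        \<le> (\<chi> i. enn2real (return_time (policy_matrix M \<sigma> \<delta>) i c)) $ i"
    using ex_return_time_bellman[of A B M c] assms(1,2) stoch acc unfolding Pols_def by auto
  define \<theta> where "\<theta> = (\<chi> i. enn2real (return_time (policy_matrix M \<sigma> \<delta>) i c))"
  interpret discountable_game A B M r c \<theta>
    using assms(1-3) ge1 ge by unfold_locales (auto simp: \<theta>_def)
  have "(\<lambda>(\<sigma>, \<delta>). return_time (policy_matrix M \<sigma> \<delta>) i c) ` Pols
      = (\<lambda>P. return_time P i c) ` (\<lambda>(\<sigma>, \<delta>). policy_matrix M \<sigma> \<delta>) ` Pols" for i
    by (auto simp: image_image intro!: image_cong)
  then have fin: "finite ((\<lambda>(\<sigma>, \<delta>). return_time (policy_matrix M \<sigma> \<delta>) i c) ` Pols)" for i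
    using finite_policy_matrices[of A B M] assms(1,2) by (simp add: Pols_def)
  have max_finite: "max_return_time A B M i c < \<infinity>" for i
    unfolding max_return_time_def Pols_def[symmetric] using fin \<pi> return_time_finite[OF stoch acc]
    by (subst Max_less_iff) auto
  define R where "R = Max (range (\<lambda>i. max_return_time A B M i c))"
  have "R < \<infinity>"
    unfolding R_def using max_finite by (subst Max_less_iff) auto
  \<comment> \<open>\<open>enn2real\<close> sends infinity to 0, so its monotonicity here rests on
    \<open>R < \<infinity>\<close>.\<close>
  have \<theta>_le: "\<theta> $ i \<le> return_bound A B M c" for i
  proof -
    have "return_time (policy_matrix M \<sigma> \<delta>) i c \<le> max_return_time A B M i c"
      unfolding max_return_time_def Pols_def[symmetric] using fin \<pi> by (intro Max_ge) force+
    also have "\<dots> \<le> R"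
      unfolding R_def by (rule Max_ge) auto
    finally show ?thesis
      using \<open>R < \<infinity>\<close> by (simp add: \<theta>_def return_bound_def R_def enn2real_mono)
  qed
  have "1 \<le> return_bound A B M c"
    using \<theta>_ge1 \<theta>_le order_trans by blast
  then have "hk_stops_within A B M r c
      (s_max (card (SIGMA i:UNIV. A i) - CARD('n)) (return_bound A B M c))"
    unfolding s_max_def
    by (intro hk_stops_within_mult[OF \<theta>_le] return_bound_power_less_one) simp_all
  then show ?thesis
    using max_finite s_max_bigo by blast
qed

end
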